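(* Let $(X,m,\rho)$ be a bounded complete Ahlfors $Q$-regular metric measure space with a fixed dyadic system and associated graph $G$, and let $0<s<1$. Given $q\ge1$, there is a constant $c_7$ such that for every nonnegative Borel measure $\omega$ on $X$, $$\int_X\left(\sum_{\alpha\in P_G(x)}\frac{\omega(\overline{Q_\alpha})}{m(\overline{Q_\alpha})^s}\right)^q dm(x)\le c_7\int_X\left(\sup_{\alpha\in P_G(x)}\frac{\omega(\overline{Q_\alpha})}{m(\overline{Q_\alpha})^s}\right)^q dm(x).$$
   Context: Ahlfors regularity: $(X,\rho)$ is a complete metric space, $0<\mathrm{diam}(X)<\infty$, $m\ge0$ is Borel, and $c_1r^Q\le m(B(x,r))\le c_2r^Q$ for all $x\in X$, $0\le r\le\mathrm{diam}(X)$, with constants $0<c_1<c_2$, $Q>0$. Dyadic system (exists by a theorem of M. Christ, up to rescaling the distance): constants $\delta\in(0,1)$, $a_0,c_4>0$, index sets $I_k$ ($k\in\mathbb N=\{0,1,\dots\}$), and open sets $Q^k_\alpha\subseteq X$ ($\alpha\in I_k$) with: (i) $m(X\setminus\bigcup_{\alpha\in I_k}Q^k_\alpha)=0$ for all $k$; (ii) if $l\ge k$, $\alpha\in I_k$, $\beta\in I_l$, then $Q^l_\beta\subseteq Q^k_\alpha$ or $Q^l_\beta\cap Q^k_\alpha=\emptyset$, and distinct sets with the same $k$ are disjoint; (iii) for $l>k$ and $\beta\in I_l$ there is a unique $\alpha\in I_k$ with $Q^l_\beta\subseteq Q^k_\alpha$; (iv) $\mathrm{diam}(Q^k_\alpha)\le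 c_4\delta^k$; (v) $B(z^k_\alpha,a_0\delta^k)\subseteq Q^k_\alpha$ for a distinguished point $z^k_\alpha\in Q^k_\alpha$; moreover $I_0=\{o\}$ and $Q^0_o=X$. Tree $T$ and graph $G$: both have as vertices the pairs $(k,\alpha)$, $\alpha\in I_k$ (written $\alpha$, level $d(\alpha)=k$, $Q_\alpha=Q^k_\alpha$). In $T$, $\alpha,\beta$ are joined by an edge if $d(\beta)=d(\alpha)+1$ and $Q_\beta\subseteq Q_\alpha$, or vice versa. $G$ has these edges and, in addition, an edge between distinct $\alpha,\beta$ with $d(\alpha)=d(\beta)=k$ whenever there are $x\in Q_\alpha$, $y\in Q_\beta$ with $\rho(x,y)\le\delta^k$. $d_G$ is the edge-counting distance in $G$. $\partial T$ is the set of infinite geodesics $\xi=(\xi_n)_{n\ge0}$ of $T$ with $\xi_0=o$, $d(\xi_n)=n$, and $\Lambda:\partial T\to X$ maps $\xi$ to the unique point of $\bigcap_n\overline{Q_{\xi_n}}$. For $x\in X$, $$P_G(x)=\{\alpha\in G:\ d_G(\alpha,\xi_n)\le1\text{ for some }\xi\in\Lambda^{-1}(x)\text{ and some }n\ge0\}.$$ The constant $c_7$ may depend on $X$, the dyadic system, $s$ and $q$, but not on $\omega$. *)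

theory Defs
  imports "HOL-Analysis.Analysis" "HOL-Library.Extended_Nat"
begin

text \<open>The space \<open>X\<close> is the whole type \<open>'a\<close>; balls are open.  Boundedness is stated separately because
  \<^const>\<open>diameter\<close> is real-valued and meaningful only for bounded sets.\<close>

locale ahlfors_regular =
  fixes m :: "'a::complete_space measure" and c1 c2 D :: real
  assumes borel_m: "sets m = sets borel"
    and bounded_space: "bounded (UNIV :: 'a set)"
    and diameter_pos: "0 < diameter (UNIV :: 'a set)"
    and constants: "0 < c1" "c1 < c2" "0 < D"
    and lower_regular: "\<And>x r. 0 \<le> r \<Longrightarrow> r \<le> diameter (UNIV :: 'a set) \<Longrightarrow>
          ennreal (c1 * r powr D) \<le> emeasure m (ball x r)"
    and upper_regular: "\<And>x r. 0 \<le> r \<Longrightarrow> r \<le> diameter (UNIV :: 'a set) \<Longrightarrow>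
          emeasure m (ball x r) \<le> ennreal (c2 * r powr D)"

locale dyadic_system =
  fixes m :: "'a::complete_space measure" and \<delta> a0 c4 :: real
    and I :: "nat \<Rightarrow> 'i set" and Q :: "nat \<Rightarrow> 'i \<Rightarrow> 'a set"
    and z :: "nat \<Rightarrow> 'i \<Rightarrow> 'a" and apex :: 'i
  assumes delta: "0 < \<delta>" "\<delta> < 1"
    and a0_pos: "0 < a0"
    and c4_pos: "0 < c4"
    and open_Q: "\<And>k \<alpha>. \<alpha> \<in> I k \<Longrightarrow> open (Q k \<alpha>)"
    and cover: "\<And>k. emeasure m (UNIV - (\<Union>\<alpha>\<in>I k. Q k \<alpha>)) = 0"
    and nested: "\<And>k l \<alpha> \<beta>. k \<le> l \<Longrightarrow> \<alpha> \<in> I k \<Longrightarrow> \<beta> \<in> I l \<Longrightarrow>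
          Q l \<beta> \<subseteq> Q k \<alpha> \<or> Q l \<beta> \<inter> Q k \<alpha> = {}"
    and disjoint: "\<And>k \<alpha> \<beta>. \<alpha> \<in> I k \<Longrightarrow> \<beta> \<in> I k \<Longrightarrow> Q k \<alpha> \<noteq> Q k \<beta> \<Longrightarrow>
          Q k \<alpha> \<inter> Q k \<beta> = {}"
    and ancestor: "\<And>k l \<beta>. k < l \<Longrightarrow> \<beta> \<in> I l \<Longrightarrow> \<exists>!\<alpha>. \<alpha> \<in> I k \<and> Q l \<beta> \<subseteq> Q k \<alpha>"
    and diam_Q: "\<And>k \<alpha>. \<alpha> \<in> I k \<Longrightarrow> diameter (Q k \<alpha>) \<le> c4 * \<delta> ^ k"
    and center: "\<And>k \<alpha>. \<alpha> \<in> I k \<Longrightarrow> z k \<alpha> \<in> Q k \<alpha>"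
    and inner_ball: "\<And>k \<alpha>. \<alpha> \<in> I k \<Longrightarrow> ball (z k \<alpha>) (a0 * \<delta> ^ k) \<subseteq> Q k \<alpha>"
    and I_0: "I 0 = {apex}"
    and Q_apex: "Q 0 apex = UNIV"

type_synonym 'i vertex = "nat \<times> 'i"

definition level :: "'i vertex \<Rightarrow> nat" where
  "level \<alpha> = fst \<alpha>"

definition cell :: "(nat \<Rightarrow> 'i \<Rightarrow> 'a set) \<Rightarrow> 'i vertex \<Rightarrow> 'a set" where
  "cell Q \<alpha> = Q (fst \<alpha>) (snd \<alpha>)"

definition vertices :: "(nat \<Rightarrow> 'i set) \<Rightarrow> 'i vertex set" where
  "vertices I = (SIGMA k:UNIV. I k)"

definition tree_edges ::
    "(nat \<Rightarrow> 'i set) \<Rightarrow> (nat \<Rightarrow> 'i \<Rightarrow> 'a set) \<Rightarrow> ('i vertex \<times> 'i vertex) set" where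
  "tree_edges I Q = {(\<alpha>, \<beta>). \<alpha> \<in> vertices I \<and> \<beta> \<in> vertices I \<and>
     (level \<beta> = level \<alpha> + 1 \<and> cell Q \<beta> \<subseteq> cell Q \<alpha> \<or>
      level \<alpha> = level \<beta> + 1 \<and> cell Q \<alpha> \<subseteq> cell Q \<beta>)}"

definition graph_edges ::
    "real \<Rightarrow> (nat \<Rightarrow> 'i set) \<Rightarrow> (nat \<Rightarrow> 'i \<Rightarrow> 'a::metric_space set)
      \<Rightarrow> ('i vertex \<times> 'i vertex) set" where
  "graph_edges \<delta> I Q = tree_edges I Q \<union>
     {(\<alpha>, \<beta>). \<alpha> \<in> vertices I \<and> \<beta> \<in> vertices I \<and> \<alpha> \<noteq> \<beta> \<and> level \<alpha> = level \<beta> \<and>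
        (\<exists>x\<in>cell Q \<alpha>. \<exists>y\<in>cell Q \<beta>. dist x y \<le> \<delta> ^ level \<alpha>)}"

text \<open>Least number of edges of a walk, \<open>\<infinity>\<close> if there is none.\<close>

definition edge_dist :: "('v \<times> 'v) set \<Rightarrow> 'v \<Rightarrow> 'v \<Rightarrow> enat" where
  "edge_dist E u v = (INF n\<in>{n. (u, v) \<in> E ^^ n}. enat n)"

definition geodesic_ray :: "('v \<times> 'v) set \<Rightarrow> (nat \<Rightarrow> 'v) \<Rightarrow> bool" where
  "geodesic_ray E \<xi> \<longleftrightarrow> (\<forall>i j. i \<le> j \<longrightarrow> edge_dist E (\<xi> i) (\<xi> j) = enat (j - i))"

definition tree_boundary ::
    "(nat \<Rightarrow> 'i set) \<Rightarrow> (nat \<Rightarrow> 'i \<Rightarrow> 'a set) \<Rightarrow> 'i \<Rightarrow> (nat \<Rightarrow> 'i vertex) set" where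
  "tree_boundary I Q apex = {\<xi>. range \<xi> \<subseteq> vertices I \<and> geodesic_ray (tree_edges I Q) \<xi> \<and>
     \<xi> 0 = (0, apex) \<and> (\<forall>n. level (\<xi> n) = n)}"

definition boundary_map ::
    "(nat \<Rightarrow> 'i \<Rightarrow> 'a::topological_space set) \<Rightarrow> (nat \<Rightarrow> 'i vertex) \<Rightarrow> 'a" where
  "boundary_map Q \<xi> = (THE x. x \<in> (\<Inter>n. closure (cell Q (\<xi> n))))"

definition P_G ::
    "real \<Rightarrow> (nat \<Rightarrow> 'i set) \<Rightarrow> (nat \<Rightarrow> 'i \<Rightarrow> 'a::metric_space set) \<Rightarrow> 'i \<Rightarrow> 'a \<Rightarrow> 'i vertex set"
  where
  "P_G \<delta> I Q apex x = {\<alpha> \<in> vertices I. \<exists>\<xi>\<in>tree_boundary I Q apex. boundary_map Q \<xi> = x \<and>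
     (\<exists>n. edge_dist (graph_edges \<delta> I Q) \<alpha> (\<xi> n) \<le> 1)}"

text \<open>Powers with a positive real exponent on \<open>[0, \<infinity>]\<close>.\<close>

definition ennpowr :: "ennreal \<Rightarrow> real \<Rightarrow> ennreal" where
  "ennpowr t p = (if t = \<infinity> then \<infinity> else ennreal (enn2real t powr p))"

end

theory Submission
  imports Defs
begin

text \<open>
  For almost every \<open>x\<close> the ray \<open>(\<beta>\<^sub>n)\<close> ending at \<open>x\<close> is unique, and the sum over \<open>P\<^sub>G(x)\<close> is bounded by
  a multiple of \<open>\<Sum>n. g n x\<close>, where \<open>g n x = (\<Sum>\<alpha>. \<omega>(closure Q\<^sub>\<alpha>)) / \<delta> powr (n D s)\<close>, \<open>\<alpha>\<close> ranging over
  \<open>\<beta>\<^sub>n\<close> and its neighbours of level \<open>n\<close>.  Since \<open>s < 1\<close> and the closed cells of one level have bounded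
  overlap, summing a geometric series gives the Carleson condition
  \<open>\<integral>\<^bsub>Q\<^esub> (\<Sum>k\<ge>j. g k) dm \<le> C \<integral>\<^bsub>Q\<^esub> g j dm\<close> for cells \<open>Q\<close> of level \<open>j\<close>.

  Put \<open>F k = g 0 + \<dots> + g k\<close>, \<open>d j = F j powr (q - 1) - F (j - 1) powr (q - 1)\<close> and \<open>M = sup g\<close>.  As \<open>d j\<close>
  is constant on cells of level \<open>j\<close>, two summations by parts give, for \<open>F = F n\<close>,
  \<open>\<integral> F powr q \<le> q \<Sum>k. \<integral> g k * F k powr (q - 1) = q \<Sum>j. \<integral> d j * (\<Sum>k\<ge>j. g k)
    \<le> q C \<Sum>j. \<integral> d j * g j \<le> q C \<integral> F powr (q - 1) * M\<close>,
  and Young's inequality absorbs \<open>F\<close> into the left-hand side, which is finite.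

  Ahlfors regularity for radii up to the diameter does not exclude \<open>m(X) = \<infinity>\<close>; in that case either all
  terms vanish or the right-hand side is infinite.
\<close>

section \<open>Sums satisfying a Carleson condition\<close>

text \<open>The mean value theorem on \<open>[b, a]\<close>, where the derivative is largest at
  \<open>a\<close>. The case \<open>b = 0\<close> is separate because the derivative is taken at
  positive arguments.\<close>

lemma powr_diff_le:
  fixes a b q :: real
  assumes "0 \<le> b" "b \<le> a" "1 \<le> q"
  shows "a powr q - b powr q \<le> q * ((a - b) * a powr (q - 1))"
proof -
  have split: "a powr q = a * a powr (q - 1)"
    using assms by (cases "a = 0") (auto simp: powr_diff)
  consider "b = 0" | "b = a" | "0 < b" "b < a" using assms by linarith
  then show ?thesis
  proof cases
    case 1
    have "1 * (a * a powr (q - 1)) \<le> q * (a * a powr (q - 1))"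
      using assms by (intro mult_right_mono) auto
    then show ?thesis using 1 split by simp
  next
    case 2 then show ?thesis by simp
  next
    case 3
    obtain u where u: "b < u" "u < a" "a powr q - b powr q = (a - b) * (q * u powr (q - 1))"
      using MVT2[of b a "\<lambda>x. x powr q" "\<lambda>x. q * x powr (q - 1)"] 3
        has_real_derivative_powr[of _ q] by force
    have "u powr (q - 1) \<le> a powr (q - 1)"
      using u 3 assms by (intro powr_mono2) auto
    then have "(a - b) * (q * u powr (q - 1)) \<le> (a - b) * (q * a powr (q - 1))"
      using 3 assms by (intro mult_left_mono) auto
    then show ?thesis using u by (simp add: mult_ac)
  qed
qed

text \<open>Compare \<open>b\<close> with \<open>e * a\<close>: the first summand alone suffices if
  \<open>b\<close> is the smaller one, the second alone otherwise.\<close>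

lemma powr_mult_le_Young:
  fixes a b e q :: real
  assumes "0 \<le> a" "0 \<le> b" "0 < e" "1 \<le> q"
  shows "a powr (q - 1) * b \<le> e * a powr q + e powr (1 - q) * b powr q"
proof (cases "b \<le> e * a")
  case True
  have "a powr (q - 1) * b \<le> a powr (q - 1) * (e * a)"
    using True by (intro mult_left_mono) auto
  also have "\<dots> = e * a powr q"
    using assms by (cases "a = 0") (auto simp: powr_diff)
  also have "\<dots> \<le> e * a powr q + e powr (1 - q) * b powr q" by simp
  finally show ?thesis .
next
  case False
  then have b: "0 < b" "a \<le> b / e"
    using assms by (auto simp: field_simps intro: le_less_trans[of 0 "e * a"])
  have "a powr (q - 1) * b \<le> (b / e) powr (q - 1) * b"
    using b assms by (intro mult_right_mono powr_mono2) auto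
  also have "\<dots> = e powr (1 - q) * b powr q"
    using b assms by (simp add: powr_divide powr_diff field_simps)
  also have "\<dots> \<le> e * a powr q + e powr (1 - q) * b powr q" using assms by simp
  finally show ?thesis .
qed

section \<open>Real powers on the extended nonnegative reals\<close>

lemma ennpowr_ennreal: "0 \<le> x \<Longrightarrow> ennpowr (ennreal x) p = ennreal (x powr p)"
  by (simp add: ennpowr_def)

lemma ennpowr_top [simp]: "ennpowr top p = top"
  by (simp add: ennpowr_def)

lemma ennpowr_0 [simp]: "ennpowr 0 p = 0"
  by (simp add: ennpowr_def)

lemma ennpowr_pos: "0 < t \<Longrightarrow> 0 < ennpowr t p"
  by (cases t) (auto simp: ennpowr_ennreal)

text \<open>An adjunction between the powers \<open>p\<close> and \<open>1 / p\<close>, valid at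
  infinity too. Monotonicity and the estimate for suprema follow from it formally.\<close>

lemma ennpowr_le_iff:
  assumes "0 < p"
  shows "ennpowr t p \<le> y \<longleftrightarrow> t \<le> ennpowr y (1 / p)"
proof (cases t; cases y)
  fix a b assume t: "t = ennreal a" "0 \<le> a" and y: "y = ennreal b" "0 \<le> b"
  have "a powr p \<le> b \<longleftrightarrow> a \<le> b powr (1 / p)"
    using powr_mono2[of p a "b powr (1 / p)"] powr_mono2[of "1 / p" "a powr p" b] assms t(2) y(2)
    by (auto simp: powr_powr)
  then show ?thesis using t y by (simp add: ennpowr_ennreal)
qed (auto simp: ennpowr_ennreal top_unique)

lemma ennpowr_mono:
  assumes "0 < p" "t \<le> u"
  shows "ennpowr t p \<le> ennpowr u p"
proof -
  have "u \<le> ennpowr (ennpowr u p) (1 / p)" using ennpowr_le_iff[OF assms(1)] by blast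
  then show ?thesis using ennpowr_le_iff[OF assms(1)] assms(2) by (metis order_trans)
qed

lemma ennpowr_SUP_le:
  assumes "0 < p"
  shows "ennpowr (SUP i\<in>A. f i) p \<le> (SUP i\<in>A. ennpowr (f i) p)"
  unfolding ennpowr_le_iff[OF assms]
proof (rule SUP_least)
  fix i assume "i \<in> A"
  then have "ennpowr (f i) p \<le> (SUP i\<in>A. ennpowr (f i) p)" by (rule SUP_upper)
  then show "f i \<le> ennpowr (SUP i\<in>A. ennpowr (f i) p) (1 / p)"
    by (simp add: ennpowr_le_iff[OF assms])
qed

section \<open>The abstract estimate for simple functions on a finite measure space\<close>

lemma (in finite_measure) integrable_simple_function_real:
  fixes f :: "'a \<Rightarrow> real"
  assumes "simple_function M f"
  shows "integrable M f"
  by (intro integrable_simple_function[OF assms]) (simp add: emeasure_eq_measure)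

text \<open>This separates the analysis from the dyadic geometry: test functions \<open>h\<close>
  determined by \<open>g 0\<close>, ..., \<open>g j\<close> stand in for functions constant on cells
  of level \<open>j\<close>. Simplicity makes all integrals finite, and the constant is independent
  of \<open>n\<close>, so \<open>n\<close> may later tend to infinity.\<close>

lemma (in finite_measure) Carleson_sum_powr_bound:
  fixes g :: "nat \<Rightarrow> 'a \<Rightarrow> real" and Mx :: "'a \<Rightarrow> real"
  assumes simple: "\<And>k. simple_function M (g k)" "simple_function M Mx"
    and nonneg: "\<And>k x. 0 \<le> g k x"
    and le: "\<And>k x. k \<le> n \<Longrightarrow> g k x \<le> Mx x"
    and q: "1 \<le> q" and C: "0 < C"
    and Carleson: "\<And>j h. j \<le> n \<Longrightarrow> simple_function M h \<Longrightarrow> (\<And>x. 0 \<le> h x)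
      \<Longrightarrow> (\<And>x y. (\<And>i. i \<le> j \<Longrightarrow> g i x = g i y) \<Longrightarrow> h x = h y)
      \<Longrightarrow> (\<integral>x. h x * (\<Sum>k=j..n. g k x) \<partial>M) \<le> C * (\<integral>x. h x * g j x \<partial>M)"
  shows "(\<integral>x. (\<Sum>k\<le>n. g k x) powr q \<partial>M) \<le> (2 * q * C) powr q * (\<integral>x. Mx x powr q \<partial>M)"
proof -
  \<comment> \<open>Shifted by one against the overview: \<open>F k\<close> sums the indices below
    \<open>k\<close>, so \<open>F 0\<close> vanishes and \<open>F (Suc k)\<close> includes
    \<open>g k\<close>.\<close>
  define F where "F k x = (\<Sum>i<k. g i x)" for k x
  define d where "d j x = F (Suc j) x powr (q - 1) - F j x powr (q - 1)" for j x
  have F_simple: "simple_function M (F k)" for k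
    unfolding F_def using simple by (intro simple_function_sum) auto
  have pow_simple: "simple_function M (\<lambda>x. u x powr r)" if "simple_function M u"
    for u :: "'a \<Rightarrow> real" and r
    using simple_function_compose1[OF that, of "\<lambda>t. t powr r"] by (simp add: o_def)
  have d_simple: "simple_function M (d j)" for j
    unfolding d_def by (intro simple_function_diff pow_simple F_simple)
  have F_nonneg: "0 \<le> F k x" for k x
    unfolding F_def by (intro sum_nonneg nonneg)
  have F_Suc: "F (Suc k) x = F k x + g k x" for k x by (simp add: F_def)
  have d_nonneg: "0 \<le> d j x" for j x
    unfolding d_def using F_nonneg[of j x] F_Suc[of j x] nonneg[of j x] q
    by (simp add: powr_mono2)
  \<comment> \<open>The telescoped boundary term \<open>F 0 x powr (q - 1)\<close> is 0 even for
    \<open>q = 1\<close>, because \<open>0 powr 0 = 0\<close>.\<close>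
  have d_sum: "(\<Sum>j<k. d j x) = F k x powr (q - 1)" for k x
    unfolding d_def by (subst sum_lessThan_telescope) (simp add: F_def)
  have Mx_nonneg: "0 \<le> Mx x" for x using nonneg[of 0 x] le[of 0 x] by simp
  have int: "integrable M u" if "simple_function M u" for u :: "'a \<Rightarrow> real"
    using that by (rule integrable_simple_function_real)
  have smul: "simple_function M (\<lambda>x. u x * v x)" if "simple_function M u" "simple_function M v"
    for u v :: "'a \<Rightarrow> real"
    using that by auto
  define f where "f x = F (Suc n) x" for x
  have f_simple: "simple_function M f" unfolding f_def by (rule F_simple)
  \<comment> \<open>Telescope \<open>F k x powr q\<close> and apply \<open>powr_diff_le\<close> to
    each increment.\<close>
  have "f x powr q \<le> q * (\<Sum>k\<le>n. g k x * F (Suc k) x powr (q - 1))" for x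
  proof -
    have "f x powr q = (\<Sum>k<Suc n. F (Suc k) x powr q - F k x powr q)"
      unfolding f_def by (subst sum_lessThan_telescope) (simp add: F_def)
    also have "\<dots> \<le> (\<Sum>k<Suc n. q * (g k x * F (Suc k) x powr (q - 1)))"
    proof (rule sum_mono)
      fix k
      show "F (Suc k) x powr q - F k x powr q \<le> q * (g k x * F (Suc k) x powr (q - 1))"
        using powr_diff_le[of "F k x" "F (Suc k) x" q] F_nonneg[of k x] nonneg[of k x] q
        by (simp add: F_Suc)
    qed
    finally show ?thesis by (simp add: sum_distrib_left lessThan_Suc_atMost)
  qed
  \<comment> \<open>Summation by parts: expand \<open>F (Suc k) x powr (q - 1)\<close> into the
    \<open>d j x\<close> with \<open>j \<le> k\<close> and exchange the two sums.\<close>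
  moreover have "(\<Sum>k\<le>n. g k x * F (Suc k) x powr (q - 1))
      = (\<Sum>j\<le>n. d j x * (\<Sum>k=j..n. g k x))" for x
  proof -
    have "(\<Sum>k\<le>n. g k x * F (Suc k) x powr (q - 1)) = (\<Sum>k\<le>n. \<Sum>j\<le>k. g k x * d j x)"
      by (simp add: d_sum[symmetric] sum_distrib_left lessThan_Suc_atMost)
    also have "\<dots> = (\<Sum>j\<le>n. \<Sum>k=j..n. g k x * d j x)"
      by (induction n) (auto simp: sum.distrib)
    finally show ?thesis by (simp add: sum_distrib_left mult.commute)
  qed
  ultimately have pointwise: "f x powr q \<le> q * (\<Sum>j\<le>n. d j x * (\<Sum>k=j..n. g k x))" for x
    by simp
  define N where "N = (\<integral>x. f x powr q \<partial>M)"
  define K where "K = (\<integral>x. Mx x powr q \<partial>M)"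
  \<comment> \<open>Chosen so that \<open>q * C * e = 1 / 2\<close>: the term of Young's inequality
    containing \<open>f\<close> then amounts to \<open>N / 2\<close> and is absorbed on the
    left.\<close>
  define e where "e = 1 / (2 * q * C)"
  have e: "0 < e" using q C by (simp add: e_def)
  have s1: "simple_function M (\<lambda>x. d j x * (\<Sum>k=j..n. g k x))" for j
    using simple by (intro smul d_simple simple_function_sum) auto
  have s2: "simple_function M (\<lambda>x. d j x * g j x)" for j
    by (intro smul d_simple simple)
  have "N \<le> (\<integral>x. q * (\<Sum>j\<le>n. d j x * (\<Sum>k=j..n. g k x)) \<partial>M)"
    unfolding N_def using s1 
    by (intro integral_mono pointwise int pow_simple f_simple integrable_mult_right integrable_sum) auto
  also have "\<dots> = q * (\<Sum>j\<le>n. \<integral>x. d j x * (\<Sum>k=j..n. g k x) \<partial>M)"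
    using s1 by (simp add: integral_sum int)
  also have "\<dots> \<le> q * (\<Sum>j\<le>n. C * (\<integral>x. d j x * g j x \<partial>M))"
  proof (intro mult_left_mono sum_mono Carleson d_simple d_nonneg)
    \<comment> \<open>\<open>d j\<close> is built from \<open>F j\<close> and
      \<open>F (Suc j)\<close>, hence from \<open>g 0\<close>, ..., \<open>g j\<close> alone, and so
      is an admissible test function.\<close>
    fix j x y assume eq: "\<And>i. i \<le> j \<Longrightarrow> g i x = g i y"
    then show "d j x = d j y" unfolding d_def F_def by (simp add: lessThan_Suc_atMost)
  qed (use q in auto)
  also have "\<dots> = q * C * (\<integral>x. (\<Sum>j\<le>n. d j x * g j x) \<partial>M)"
    using s2 by (simp add: integral_sum int sum_distrib_left mult.assoc)
  also have "\<dots> \<le> q * C * (\<integral>x. e * f x powr q + e powr (1 - q) * Mx x powr q \<partial>M)"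
  proof (intro mult_left_mono integral_mono)
    fix x
    have "(\<Sum>j\<le>n. d j x * g j x) \<le> (\<Sum>j\<le>n. d j x * Mx x)"
      by (intro sum_mono mult_left_mono le d_nonneg) auto
    also have "\<dots> = f x powr (q - 1) * Mx x"
      by (simp add: f_def sum_distrib_right[symmetric] d_sum[symmetric] lessThan_Suc_atMost)
    also have "\<dots> \<le> e * f x powr q + e powr (1 - q) * Mx x powr q"
      unfolding f_def by (intro powr_mult_le_Young F_nonneg Mx_nonneg e q)
    finally show "(\<Sum>j\<le>n. d j x * g j x) \<le> e * f x powr q + e powr (1 - q) * Mx x powr q" .
  next
    show "integrable M (\<lambda>x. \<Sum>j\<le>n. d j x * g j x)" by (intro Bochner_Integration.integrable_sum int[OF s2])
    show "integrable M (\<lambda>x. e * f x powr q + e powr (1 - q) * Mx x powr q)"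
      using simple f_simple by (intro Bochner_Integration.integrable_add integrable_mult_right int[OF pow_simple])
  qed (use q C in auto)
  also have "\<dots> = q * C * (e * N + e powr (1 - q) * K)"
    using simple f_simple by (simp add: N_def K_def int pow_simple)
  also have "\<dots> = N / 2 + q * C * e powr (1 - q) * K"
    using q C by (simp add: e_def field_simps)
  finally have "N \<le> 2 * q * C * e powr (1 - q) * K" by (simp add: field_simps)
  also have "e powr (1 - q) = (2 * q * C) powr (q - 1)"
    using q C by (simp add: e_def powr_divide powr_diff)
  also have "2 * q * C * (2 * q * C) powr (q - 1) = (2 * q * C) powr q"
    using q C by (simp add: powr_diff)
  finally show ?thesis
    by (simp add: N_def K_def f_def F_def lessThan_Suc_atMost)
qed

section \<open>Geodesic rays and dyadic cells\<close>

text \<open>A nonempty set of naturals attains its infimum; the empty set gives infinity, which lies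
  below no \<open>enat n\<close>.\<close>

lemma edge_dist_le_iff: "edge_dist E u v \<le> enat n \<longleftrightarrow> (\<exists>k\<le>n. (u, v) \<in> E ^^ k)"
proof
  assume le: "edge_dist E u v \<le> enat n"
  let ?A = "enat ` {k. (u, v) \<in> E ^^ k}"
  have "?A \<noteq> {}"
  proof
    assume "?A = {}"
    then have "edge_dist E u v = \<infinity>"
      unfolding edge_dist_def by (simp only: Inf_empty top_enat_def)
    with le show False by simp
  qed
  then have "Inf ?A \<in> ?A" by (auto simp: Inf_enat_def intro: LeastI)
  then show "\<exists>k\<le>n. (u, v) \<in> E ^^ k" using le by (auto simp: edge_dist_def)
next
  assume "\<exists>k\<le>n. (u, v) \<in> E ^^ k"
  then obtain k where "k \<le> n" "(u, v) \<in> E ^^ k" by blast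
  then show "edge_dist E u v \<le> enat n"
    unfolding edge_dist_def by (intro INF_lower2[of k]) auto
qed

lemma edge_dist_le_1_iff: "edge_dist E u v \<le> 1 \<longleftrightarrow> u = v \<or> (u, v) \<in> E"
proof -
  have "(\<exists>k\<le>Suc 0. p k) \<longleftrightarrow> p 0 \<or> p (Suc 0)" for p :: "nat \<Rightarrow> bool"
    by (metis le_Suc_eq le_zero_eq order_refl)
  from this[of "\<lambda>k. (u, v) \<in> E ^^ k"] show ?thesis
    by (simp add: edge_dist_le_iff one_enat_def)
qed

lemma tree_edges_relpow_level: "(u, v) \<in> tree_edges I Q ^^ n \<Longrightarrow> level v \<le> level u + n"
proof (induction n arbitrary: v)
  case (Suc n)
  then obtain w where "(u, w) \<in> tree_edges I Q ^^ n" "(w, v) \<in> tree_edges I Q" by auto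
  then show ?case using Suc.IH[of w] by (auto simp: tree_edges_def)
qed simp

lemma vertices_iff: "\<alpha> \<in> vertices I \<longleftrightarrow> snd \<alpha> \<in> I (fst \<alpha>)"
  by (cases \<alpha>) (simp add: vertices_def)

text \<open>An edge raises the level by at most one, so no walk between two vertices of the ray is
  shorter than the ray itself.\<close>

lemma geodesic_ray_treeI:
  assumes edge: "\<And>n. (\<xi> n, \<xi> (Suc n)) \<in> tree_edges I Q" and level: "\<And>n. level (\<xi> n) = n"
  shows "geodesic_ray (tree_edges I Q) \<xi>"
  unfolding geodesic_ray_def
proof (intro allI impI antisym)
  fix i j :: nat assume "i \<le> j"
  have "(\<xi> i, \<xi> (i + n)) \<in> tree_edges I Q ^^ n" for n
    by (induction n) (auto intro: edge)
  from this[of "j - i"] show "edge_dist (tree_edges I Q) (\<xi> i) (\<xi> j) \<le> enat (j - i)"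
    using \<open>i \<le> j\<close> by (auto simp: edge_dist_le_iff)
  show "enat (j - i) \<le> edge_dist (tree_edges I Q) (\<xi> i) (\<xi> j)"
    unfolding edge_dist_def
  proof (rule INF_greatest)
    fix n assume "n \<in> {n. (\<xi> i, \<xi> j) \<in> tree_edges I Q ^^ n}"
    then have "level (\<xi> j) \<le> level (\<xi> i) + n" by (intro tree_edges_relpow_level) simp
    then show "enat (j - i) \<le> enat n" using level by simp
  qed
qed

text \<open>Consecutive vertices of a geodesic ray are at distance one; their levels exclude
  equality and fix the direction of the edge between them.\<close>

lemma tree_boundaryD:
  assumes "\<xi> \<in> tree_boundary I Q apex"
  shows "\<xi> n \<in> vertices I" "level (\<xi> n) = n" "cell Q (\<xi> (Suc n)) \<subseteq> cell Q (\<xi> n)"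
proof -
  have level: "level (\<xi> k) = k" for k using assms by (simp add: tree_boundary_def)
  then show "level (\<xi> n) = n" .
  show "\<xi> n \<in> vertices I" using assms by (auto simp: tree_boundary_def)
  have "edge_dist (tree_edges I Q) (\<xi> n) (\<xi> (Suc n)) = enat (Suc n - n)"
    using assms by (simp add: tree_boundary_def geodesic_ray_def)
  then have "edge_dist (tree_edges I Q) (\<xi> n) (\<xi> (Suc n)) \<le> 1" by (simp add: one_enat_def)
  then have "\<xi> n = \<xi> (Suc n) \<or> (\<xi> n, \<xi> (Suc n)) \<in> tree_edges I Q"
    unfolding edge_dist_le_1_iff .
  then show "cell Q (\<xi> (Suc n)) \<subseteq> cell Q (\<xi> n)"
    using level[of n] level[of "Suc n"] by (auto simp: tree_edges_def)
qed

section \<open>Size and uniqueness of dyadic cells in a regular space\<close>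

locale dyadic_ahlfors =
  ahlfors_regular m c1 c2 D + dyadic_system m \<delta> a0 c4 I Q z apex
  for m :: "'a::complete_space measure" and c1 c2 D \<delta> a0 c4 :: real
    and I :: "nat \<Rightarrow> 'i set" and Q :: "nat \<Rightarrow> 'i \<Rightarrow> 'a set"
    and z :: "nat \<Rightarrow> 'i \<Rightarrow> 'a" and apex :: 'i
begin

lemma space_m [simp]: "space m = UNIV"
  using sets_eq_imp_space_eq[OF borel_m] by simp

lemma sets_m_open [measurable]: "open U \<Longrightarrow> U \<in> sets m"
  by (simp add: borel_m)

lemma sets_m_closed: "closed U \<Longrightarrow> U \<in> sets m"
  by (simp add: borel_m)

lemma bounded_set [simp]: "bounded (S :: 'a set)"
  using bounded_space bounded_subset by blast

lemma dist_closure_cell: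
  assumes "\<alpha> \<in> I k" "x \<in> closure (Q k \<alpha>)" "y \<in> closure (Q k \<alpha>)"
  shows "dist x y \<le> c4 * \<delta> ^ k"
proof -
  have "dist x y \<le> diameter (closure (Q k \<alpha>))"
    using assms by (intro diameter_bounded_bound) auto
  also have "\<dots> \<le> c4 * \<delta> ^ k" using diam_Q[OF assms(1)] by (simp add: diameter_closure)
  finally show ?thesis .
qed

lemma dist_cell:
  assumes "\<alpha> \<in> I k" "x \<in> Q k \<alpha>" "y \<in> Q k \<alpha>"
  shows "dist x y \<le> c4 * \<delta> ^ k"
  using assms closure_subset by (blast intro: dist_closure_cell)

text \<open>The inner radius is cut down to the diameter because lower regularity is available only
  up to that radius.\<close>

definition inner :: real where "inner = min a0 (diameter (space m))"
definition mass :: real where "mass = c1 * inner powr D"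
text \<open>The factor by which the measure of a cell scales from one level to the next.\<close>

definition \<rho> :: real where "\<rho> = \<delta> powr D"

lemma inner: "0 < inner" "inner \<le> a0" "inner \<le> diameter (UNIV :: 'a set)"
  using a0_pos diameter_pos by (auto simp: inner_def)

lemma mass_pos: "0 < mass"
  using inner constants by (simp add: mass_def)

lemma rho: "0 < \<rho>" "\<rho> < 1"
  using delta constants powr_less_mono2[of D \<delta> 1] by (auto simp: \<rho>_def)

lemma delta_power: "0 < \<delta> ^ k" "\<delta> ^ k \<le> 1"
  using delta by (auto intro: power_le_one)

lemma delta_power_powr: "(\<delta> ^ k) powr D = \<rho> ^ k"
  using delta by (simp add: \<rho>_def powr_realpow[symmetric] powr_powr mult.commute)

lemma inner_ball_lower: "ennreal (mass * \<rho> ^ k) \<le> emeasure m (ball x (inner * \<delta> ^ k))"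
proof -
  have "inner * \<delta> ^ k \<le> diameter (UNIV :: 'a set) * 1"
    using inner delta_power[of k] diameter_pos by (intro mult_mono) auto
  then have "ennreal (c1 * (inner * \<delta> ^ k) powr D) \<le> emeasure m (ball x (inner * \<delta> ^ k))"
    using inner delta_power[of k] by (intro lower_regular) auto
  then show ?thesis
    by (simp add: powr_mult delta_power_powr mass_def mult.assoc)
qed

lemma inner_ball_subset:
  assumes "\<alpha> \<in> I k"
  shows "ball (z k \<alpha>) (inner * \<delta> ^ k) \<subseteq> Q k \<alpha>"
proof -
  have "inner * \<delta> ^ k \<le> a0 * \<delta> ^ k" using inner delta_power[of k] by (intro mult_right_mono) auto
  then show ?thesis using inner_ball[OF assms] by (meson order_trans subset_ball)
qed

lemma cell_lower:
  assumes "\<alpha> \<in> I k"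
  shows "ennreal (mass * \<rho> ^ k) \<le> emeasure m (Q k \<alpha>)"
proof -
  have "emeasure m (ball (z k \<alpha>) (inner * \<delta> ^ k)) \<le> emeasure m (Q k \<alpha>)"
    using assms by (intro emeasure_mono inner_ball_subset sets_m_open open_Q)
  then show ?thesis using inner_ball_lower order_trans by blast
qed

lemma emeasure_open_pos:
  assumes "open U" "x \<in> U"
  shows "0 < emeasure m U"
proof -
  obtain e where e: "0 < e" "ball x e \<subseteq> U" using assms by (meson open_contains_ball)
  let ?r = "min e (diameter (UNIV :: 'a set))"
  have "0 < ennreal (c1 * ?r powr D)" using e diameter_pos constants by simp
  also have "\<dots> \<le> emeasure m (ball x ?r)"
    using e diameter_pos by (intro lower_regular) auto
  also have "\<dots> \<le> emeasure m U"
    using e by (intro emeasure_mono sets_m_open assms) auto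
  finally show ?thesis .
qed

text \<open>The cells of one level miss only a null set, and regularity gives every nonempty open
  set positive measure.\<close>

lemma open_meets_cell:
  assumes "open U" "x \<in> U"
  shows "\<exists>\<beta>\<in>I l. Q l \<beta> \<inter> U \<noteq> {}"
proof (rule ccontr)
  assume "\<not> ?thesis"
  then have "U \<subseteq> UNIV - (\<Union>\<alpha>\<in>I l. Q l \<alpha>)" by blast
  moreover have "UNIV - (\<Union>\<alpha>\<in>I l. Q l \<alpha>) \<in> sets m"
    by (intro sets_m_closed) (use open_Q in auto)
  ultimately have "emeasure m U \<le> emeasure m (UNIV - (\<Union>\<alpha>\<in>I l. Q l \<alpha>))"
    by (intro emeasure_mono)
  with emeasure_open_pos[OF assms] cover[of l] show False by simp
qed

lemma cell_subset_if_meet: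
  "k \<le> l \<Longrightarrow> \<alpha> \<in> I k \<Longrightarrow> \<beta> \<in> I l \<Longrightarrow> Q l \<beta> \<inter> Q k \<alpha> \<noteq> {} \<Longrightarrow> Q l \<beta> \<subseteq> Q k \<alpha>"
  using nested by blast

text \<open>A common child of two equal cells has only one parent.\<close>

lemma cell_inject:
  assumes "\<alpha> \<in> I k" "\<beta> \<in> I k" "Q k \<alpha> = Q k \<beta>"
  shows "\<alpha> = \<beta>"
proof -
  obtain \<gamma> where \<gamma>: "\<gamma> \<in> I (Suc k)" "Q (Suc k) \<gamma> \<inter> Q k \<alpha> \<noteq> {}"
    using open_meets_cell[OF open_Q center] assms(1) by blast
  then have "Q (Suc k) \<gamma> \<subseteq> Q k \<alpha>" using assms by (intro cell_subset_if_meet) auto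
  then show ?thesis using ancestor[of k "Suc k" \<gamma>] \<gamma> assms by auto
qed

lemma cell_unique:
  "\<alpha> \<in> I k \<Longrightarrow> \<beta> \<in> I k \<Longrightarrow> x \<in> Q k \<alpha> \<Longrightarrow> x \<in> Q k \<beta> \<Longrightarrow> \<alpha> = \<beta>"
  using disjoint[of \<alpha> k \<beta>] cell_inject[of \<alpha> k \<beta>] by blast

text \<open>An open set that meets a closure meets the set itself. This is what makes the ray ending
  at a typical point unique.\<close>

lemma closure_cell_unique:
  assumes "\<alpha> \<in> I k" "\<beta> \<in> I k" "x \<in> Q k \<alpha>" "x \<in> closure (Q k \<beta>)"
  shows "\<alpha> = \<beta>"
proof -
  have "Q k \<alpha> \<inter> Q k \<beta> \<noteq> {}"
    using open_Int_closure_eq_empty[OF open_Q[OF assms(1)]] assms by blast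
  then show ?thesis using cell_unique assms by blast
qed

section \<open>Points interior to a cell at every level, and their unique rays\<close>

definition good :: "'a set" where "good = {x. \<forall>k. \<exists>\<alpha>\<in>I k. x \<in> Q k \<alpha>}"

definition index :: "nat \<Rightarrow> 'a \<Rightarrow> 'i" where "index k x = (THE \<alpha>. \<alpha> \<in> I k \<and> x \<in> Q k \<alpha>)"

definition ray :: "'a \<Rightarrow> nat \<Rightarrow> 'i vertex" where "ray x n = (n, index n x)"

lemma AE_good: "AE x in m. x \<in> good"
proof -
  have "AE x in m. \<exists>\<alpha>\<in>I k. x \<in> Q k \<alpha>" for k
  proof (rule AE_I)
    show "UNIV - (\<Union>\<alpha>\<in>I k. Q k \<alpha>) \<in> sets m"
      by (intro sets_m_closed) (use open_Q in auto)
  qed (use cover in auto)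
  then show ?thesis unfolding good_def by (simp add: AE_all_countable)
qed

lemma index_eq: "\<alpha> \<in> I k \<Longrightarrow> x \<in> Q k \<alpha> \<Longrightarrow> index k x = \<alpha>"
  unfolding index_def using cell_unique by blast

lemma index:
  assumes "x \<in> good"
  shows "index k x \<in> I k" "x \<in> Q k (index k x)"
proof -
  obtain \<alpha> where "\<alpha> \<in> I k" "x \<in> Q k \<alpha>" using assms unfolding good_def by blast
  then show "index k x \<in> I k" "x \<in> Q k (index k x)" using index_eq by simp_all
qed

lemma cell_index_mono:
  assumes "x \<in> good" "k \<le> l"
  shows "Q l (index l x) \<subseteq> Q k (index k x)"
proof (rule cell_subset_if_meet)
  show "Q l (index l x) \<inter> Q k (index k x) \<noteq> {}" using index(2)[OF assms(1)] by blast
qed (simp_all add: assms index)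

text \<open>Cantor's intersection theorem in a complete space: the closed cells along a ray are
  nested and their diameters tend to 0. Thus the definite description in \<open>boundary_map\<close>
  is meaningful.\<close>

lemma boundary_map_in_closure:
  assumes "\<xi> \<in> tree_boundary I Q apex"
  shows "(\<Inter>n. closure (cell Q (\<xi> n))) = {boundary_map Q \<xi>}"
proof -
  note \<xi> = tree_boundaryD[OF assms]
  have cell: "cell Q (\<xi> n) = Q n (snd (\<xi> n))" "snd (\<xi> n) \<in> I n" for n
    using \<xi>(1,2)[of n] by (simp_all add: cell_def level_def vertices_iff)
  have "\<exists>x. (\<Inter>n. closure (cell Q (\<xi> n))) = {x}"
  proof (rule decreasing_closed_nest_sing)
    fix n show "closure (cell Q (\<xi> n)) \<noteq> {}"
      using center[OF cell(2)[of n]] unfolding cell(1) closure_eq_empty by blast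
  next
    fix k n :: nat assume "k \<le> n"
    then show "closure (cell Q (\<xi> n)) \<subseteq> closure (cell Q (\<xi> k))"
      using lift_Suc_antimono_le[of "\<lambda>n. cell Q (\<xi> n)" k n] \<xi>(3) by (intro closure_mono) simp
  next
    fix e :: real assume "0 < e"
    then obtain n where "\<delta> ^ n < e / c4"
      using real_arch_pow_inv[of "e / c4" \<delta>] delta c4_pos by (metis divide_pos_pos)
    then have "c4 * \<delta> ^ n < e" using c4_pos by (simp add: pos_less_divide_eq mult.commute)
    have "dist x y < e" if "x \<in> closure (cell Q (\<xi> n))" "y \<in> closure (cell Q (\<xi> n))" for x y
    proof -
      have "dist x y \<le> c4 * \<delta> ^ n"
        using that unfolding cell(1) by (rule dist_closure_cell[OF cell(2)])
      then show ?thesis using \<open>c4 * \<delta> ^ n < e\<close> by simp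
    qed
    then show "\<exists>n. \<forall>x\<in>closure (cell Q (\<xi> n)). \<forall>y\<in>closure (cell Q (\<xi> n)). dist x y < e"
      by blast
  qed simp
  then obtain x where x: "(\<Inter>n. closure (cell Q (\<xi> n))) = {x}" by blast
  then have "boundary_map Q \<xi> = x" unfolding boundary_map_def by simp
  with x show ?thesis by simp
qed

lemma ray_in_tree_boundary:
  assumes "x \<in> good"
  shows "ray x \<in> tree_boundary I Q apex" "boundary_map Q (ray x) = x"
proof -
  have vertex: "ray x n \<in> vertices I" for n
    using index[OF assms] by (auto simp: ray_def vertices_iff)
  have level: "level (ray x n) = n" for n by (simp add: level_def ray_def)
  have "cell Q (ray x (Suc n)) \<subseteq> cell Q (ray x n)" for n
    using cell_index_mono[OF assms, of n "Suc n"] by (simp add: cell_def ray_def)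
  then have "(ray x n, ray x (Suc n)) \<in> tree_edges I Q" for n
    using vertex level by (simp add: tree_edges_def)
  then have "geodesic_ray (tree_edges I Q) (ray x)"
    using level by (rule geodesic_ray_treeI)
  moreover have "ray x 0 = (0, apex)"
    using index[OF assms, of 0] I_0 by (auto simp: ray_def)
  ultimately show mem: "ray x \<in> tree_boundary I Q apex"
    unfolding tree_boundary_def using vertex level by (simp add: image_subset_iff)
  have "x \<in> closure (cell Q (ray x n))" for n
    using index(2)[OF assms, of n] closure_subset[of "cell Q (ray x n)"]
    by (auto simp: ray_def cell_def)
  then have "x \<in> (\<Inter>n. closure (cell Q (ray x n)))" by blast
  then show "boundary_map Q (ray x) = x"
    unfolding boundary_map_in_closure[OF mem] by simp
qed

text \<open>At each level \<open>x\<close> lies in an open cell, and by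
  \<open>closure_cell_unique\<close> no other cell of that level has \<open>x\<close> in its
  closure.\<close>

lemma tree_boundary_unique:
  assumes "x \<in> good" "\<xi> \<in> tree_boundary I Q apex" "boundary_map Q \<xi> = x"
  shows "\<xi> = ray x"
proof
  fix n
  have mem: "x \<in> closure (cell Q (\<xi> n))"
    using boundary_map_in_closure[OF assms(2)] unfolding assms(3) by blast
  have "fst (\<xi> n) = n" "snd (\<xi> n) \<in> I n"
    using tree_boundaryD(1,2)[OF assms(2), of n] by (simp_all add: level_def vertices_iff)
  moreover from this have "index n x = snd (\<xi> n)"
    using mem index[OF assms(1), of n]
      closure_cell_unique[of "index n x" n "snd (\<xi> n)" x] by (simp add: cell_def)
  ultimately show "\<xi> n = ray x n" by (simp add: ray_def prod_eq_iff)
qed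

text \<open>With only one ray above \<open>x\<close>, the quantifier over rays disappears, and
  distance at most one means equal or joined by an edge.\<close>

lemma P_G_good:
  assumes "x \<in> good"
  shows "P_G \<delta> I Q apex x
    = {\<alpha> \<in> vertices I. \<exists>n. \<alpha> = ray x n \<or> (\<alpha>, ray x n) \<in> graph_edges \<delta> I Q}"
proof -
  have "\<xi> \<in> tree_boundary I Q apex \<and> boundary_map Q \<xi> = x \<longleftrightarrow> \<xi> = ray x" for \<xi>
    using ray_in_tree_boundary[OF assms] tree_boundary_unique[OF assms] by blast
  then have "(\<exists>\<xi>\<in>tree_boundary I Q apex. boundary_map Q \<xi> = x \<and> p \<xi>) \<longleftrightarrow> p (ray x)" for p
    by metis
  then show ?thesis unfolding P_G_def edge_dist_le_1_iff by simp
qed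

section \<open>The quotients in the theorem, and the case of infinite total mass\<close>

definition ratio :: "real \<Rightarrow> 'a measure \<Rightarrow> 'i vertex \<Rightarrow> ennreal" where
  "ratio s \<omega> \<alpha> = emeasure \<omega> (closure (cell Q \<alpha>)) / ennpowr (emeasure m (closure (cell Q \<alpha>))) s"

text \<open>The boundary of a cell contains no good point and is therefore null.\<close>

lemma emeasure_closure_cell:
  assumes "\<alpha> \<in> I k"
  shows "emeasure m (closure (Q k \<alpha>)) = emeasure m (Q k \<alpha>)"
proof (rule emeasure_eq_AE)
  show "AE x in m. x \<in> closure (Q k \<alpha>) \<longleftrightarrow> x \<in> Q k \<alpha>"
    using AE_good
  proof eventually_elim
    case (elim x)
    then show ?case
      using closure_cell_unique[OF index(1) assms index(2), of x] index[of x k] closure_subset by auto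
  qed
qed (use assms open_Q sets_m_open sets_m_closed in auto)

text \<open>Restrict the integral to a cell whose good points all have the vertex
  \<open>\<alpha>\<close> in their sets \<open>P_G\<close>. The lemma serves to show that the
  right-hand side of the theorem is infinite.\<close>

lemma integral_SUP_lower:
  assumes \<beta>: "\<beta> \<in> I k" and mem: "\<And>x. x \<in> good \<Longrightarrow> x \<in> Q k \<beta> \<Longrightarrow> \<alpha> \<in> P_G \<delta> I Q apex x"
    and q: "0 < q"
  shows "ennpowr (ratio s \<omega> \<alpha>) q * emeasure m (Q k \<beta>)
    \<le> (\<integral>\<^sup>+x. ennpowr (SUP \<alpha>\<in>P_G \<delta> I Q apex x. ratio s \<omega> \<alpha>) q \<partial>m)"
proof -
  have "ennpowr (ratio s \<omega> \<alpha>) q * emeasure m (Q k \<beta>)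
      = (\<integral>\<^sup>+x. ennpowr (ratio s \<omega> \<alpha>) q * indicator (Q k \<beta>) x \<partial>m)"
    using \<beta> by (intro nn_integral_cmult_indicator[symmetric] sets_m_open open_Q)
  also have "\<dots> \<le> (\<integral>\<^sup>+x. ennpowr (SUP \<alpha>\<in>P_G \<delta> I Q apex x. ratio s \<omega> \<alpha>) q \<partial>m)"
  proof (rule nn_integral_mono_AE)
    show "AE x in m. ennpowr (ratio s \<omega> \<alpha>) q * indicator (Q k \<beta>) x
        \<le> ennpowr (SUP \<alpha>\<in>P_G \<delta> I Q apex x. ratio s \<omega> \<alpha>) q"
      using AE_good
    proof eventually_elim
      case (elim x)
      show ?case
      proof (cases "x \<in> Q k \<beta>")
        case True
        then show ?thesis using mem[OF elim] q by (auto intro!: ennpowr_mono SUP_upper)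
      qed simp
    qed
  qed
  finally show ?thesis .
qed

lemma P_G_cell:
  assumes "\<alpha> \<in> I k" "x \<in> good" "x \<in> Q k \<alpha>"
  shows "(k, \<alpha>) \<in> P_G \<delta> I Q apex x"
  unfolding P_G_good[OF assms(2)] using assms index_eq[OF assms(1,3)]
  by (auto simp: vertices_iff ray_def)

text \<open>The ray of \<open>x\<close> passes through the parent, which is joined to all its
  children, also to those whose cells do not contain \<open>x\<close>.\<close>

lemma P_G_child:
  assumes "\<alpha> \<in> I k" "\<beta> \<in> I (Suc k)" "Q (Suc k) \<beta> \<subseteq> Q k \<alpha>" "x \<in> good" "x \<in> Q k \<alpha>"
  shows "(Suc k, \<beta>) \<in> P_G \<delta> I Q apex x"
proof -
  have "((Suc k, \<beta>), ray x k) \<in> graph_edges \<delta> I Q"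
    using assms index_eq[OF assms(1,5)]
    by (auto simp: graph_edges_def tree_edges_def ray_def vertices_iff level_def cell_def)
  then show ?thesis unfolding P_G_good[OF assms(4)] using assms(2) by (auto simp: vertices_iff)
qed

text \<open>Since \<open>c / \<infinity> = 0\<close>, a cell with positive ratio of least level is a child of a cell of infinite
  measure, and it belongs to \<open>P\<^sub>G(x)\<close> for almost all \<open>x\<close> in its parent.\<close>

lemma infinite_measure_bound:
  assumes inf: "emeasure m UNIV = top" and q: "0 < q" and \<omega>: "sets \<omega> = sets borel"
  shows "(\<integral>\<^sup>+x. ennpowr (\<Sum>\<^sub>\<infinity>\<alpha>\<in>P_G \<delta> I Q apex x. ratio s \<omega> \<alpha>) q \<partial>m)
    \<le> (\<integral>\<^sup>+x. ennpowr (SUP \<alpha>\<in>P_G \<delta> I Q apex x. ratio s \<omega> \<alpha>) q \<partial>m)"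
proof (cases "\<forall>\<alpha>\<in>vertices I. ratio s \<omega> \<alpha> = 0")
  case True
  then have "(\<Sum>\<^sub>\<infinity>\<alpha>\<in>P_G \<delta> I Q apex x. ratio s \<omega> \<alpha>) = 0" for x
    by (intro infsum_0) (auto simp: P_G_def)
  then show ?thesis by simp
next
  case False
  define pos where "pos k \<longleftrightarrow> (\<exists>\<alpha>\<in>I k. ratio s \<omega> (k, \<alpha>) \<noteq> 0)" for k
  have "\<exists>k. pos k" using False unfolding pos_def by (metis prod.collapse vertices_iff)
  define k where "k = (LEAST k. pos k)"
  have "pos k" unfolding k_def using \<open>\<exists>k. pos k\<close> by (rule LeastI_ex)
  then obtain \<alpha> where \<alpha>: "\<alpha> \<in> I k" "ratio s \<omega> (k, \<alpha>) \<noteq> 0" by (auto simp: pos_def)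
  \<comment> \<open>At level 0 the cell is the whole space, of infinite measure, so its ratio is
    0.\<close>
  have "k \<noteq> 0"
    using \<alpha> inf I_0 Q_apex by (cases k) (auto simp: ratio_def cell_def)
  then obtain j where j: "k = Suc j" by (cases k) auto
  have "\<not> pos j" using not_less_Least[of j pos] j by (auto simp: k_def)
  obtain \<beta> where \<beta>: "\<beta> \<in> I j" "Q k \<alpha> \<subseteq> Q j \<beta>" using ancestor[of j k \<alpha>] \<alpha> j by auto
  have zero: "ratio s \<omega> (j, \<beta>) = 0" using \<open>\<not> pos j\<close> \<beta> by (auto simp: pos_def)
  have "0 < emeasure \<omega> (closure (Q k \<alpha>))"
    using \<alpha>(2) by (auto simp: ratio_def cell_def zero_less_iff_neq_zero)
  also have "\<dots> \<le> emeasure \<omega> (closure (Q j \<beta>))"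
    using \<beta> \<omega> by (intro emeasure_mono closure_mono) auto
  \<comment> \<open>The parent has positive numerator but ratio 0, which forces an infinite
    denominator.\<close>
  finally have "ennpowr (emeasure m (closure (Q j \<beta>))) s = top"
    using zero by (auto simp: ratio_def cell_def)
  then have "emeasure m (Q j \<beta>) = top"
    using emeasure_closure_cell[OF \<beta>(1)] by (auto simp: ennpowr_def split: if_splits)
  moreover have "(k, \<alpha>) \<in> P_G \<delta> I Q apex x" if "x \<in> good" "x \<in> Q j \<beta>" for x
    using P_G_child[OF \<beta>(1) _ _ that] \<alpha> \<beta> j by auto
  then have "ennpowr (ratio s \<omega> (k, \<alpha>)) q * emeasure m (Q j \<beta>)
      \<le> (\<integral>\<^sup>+x. ennpowr (SUP \<alpha>\<in>P_G \<delta> I Q apex x. ratio s \<omega> \<alpha>) q \<partial>m)"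
    by (intro integral_SUP_lower[OF \<beta>(1)] q) auto
  moreover have "ennpowr (ratio s \<omega> (k, \<alpha>)) q \<noteq> 0"
    using ennpowr_pos[of "ratio s \<omega> (k, \<alpha>)" q] \<alpha>(2) by (auto simp: zero_less_iff_neq_zero)
  ultimately show ?thesis by (simp add: ennreal_mult_top top_unique)
qed

end

section \<open>Spaces of finite measure\<close>

locale finite_dyadic_ahlfors = dyadic_ahlfors m c1 c2 D \<delta> a0 c4 I Q z apex
  for m :: "'a::complete_space measure" and c1 c2 D \<delta> a0 c4 :: real
    and I :: "nat \<Rightarrow> 'i set" and Q :: "nat \<Rightarrow> 'i \<Rightarrow> 'a set"
    and z :: "nat \<Rightarrow> 'i \<Rightarrow> 'a" and apex :: 'i +
  assumes finite_m: "emeasure m UNIV \<noteq> top"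

sublocale finite_dyadic_ahlfors \<subseteq> finite_measure m
  by (rule finite_measureI) (simp add: finite_m)

section \<open>Upper volume bounds and packing of cells\<close>

context finite_dyadic_ahlfors
begin

text \<open>The second entry extends the upper regularity bound to radii beyond the diameter, where
  the total mass is used as the estimate.\<close>

definition upper :: real where "upper = max c2 (measure m UNIV / diameter (space m) powr D)"

lemma upper_pos: "0 < upper"
  using constants by (simp add: upper_def)

lemma ball_upper:
  assumes "0 \<le> r"
  shows "measure m (ball x r) \<le> upper * r powr D"
proof (cases "r \<le> diameter (UNIV :: 'a set)")
  case True
  have "emeasure m (ball x r) \<le> ennreal (c2 * r powr D)"
    using assms True by (rule upper_regular)
  then have "measure m (ball x r) \<le> c2 * r powr D"
    using constants by (simp add: emeasure_eq_measure)
  also have "\<dots> \<le> upper * r powr D" by (intro mult_right_mono) (auto simp: upper_def)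
  finally show ?thesis .
next
  case False
  let ?d = "diameter (UNIV :: 'a set)"
  have "measure m (ball x r) \<le> measure m UNIV / ?d powr D * ?d powr D"
    using bounded_measure[of "ball x r"] diameter_pos by simp
  also have "\<dots> \<le> upper * r powr D"
    using False diameter_pos constants
    by (intro mult_mono powr_mono2) (auto simp: upper_def less_imp_le)
  finally show ?thesis .
qed

text \<open>The inner balls are disjoint, each has measure at least
  \<open>mass * \<rho> ^ k\<close>, and all lie in one ball of radius
  \<open>(R + inner) * \<delta> ^ k\<close>; comparing measures bounds their number.\<close>

lemma packing:
  assumes "S \<subseteq> I k" "\<And>\<alpha>. \<alpha> \<in> S \<Longrightarrow> dist x (z k \<alpha>) \<le> R * \<delta> ^ k" "0 \<le> R"
  shows "finite S \<and> real (card S) \<le> upper * (R + inner) powr D / mass"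
proof -
  let ?B = "upper * (R + inner) powr D / mass"
  let ?b = "\<lambda>\<alpha>. ball (z k \<alpha>) (inner * \<delta> ^ k)"
  have bound: "real (card F) \<le> ?B" if F: "F \<subseteq> S" "finite F" for F
  proof -
    have sub: "?b \<alpha> \<subseteq> Q k \<alpha>" if "\<alpha> \<in> F" for \<alpha>
      using that F assms by (intro inner_ball_subset) auto
    have "disjoint_family_on ?b F"
      unfolding disjoint_family_on_def
    proof (intro ballI impI)
      fix \<alpha> \<beta> assume "\<alpha> \<in> F" "\<beta> \<in> F" "\<alpha> \<noteq> \<beta>"
      then have "Q k \<alpha> \<inter> Q k \<beta> = {}" using cell_unique[of \<alpha> k \<beta>] F assms(1) by blast
      then show "?b \<alpha> \<inter> ?b \<beta> = {}" using sub \<open>\<alpha> \<in> F\<close> \<open>\<beta> \<in> F\<close> by blast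
    qed
    then have "measure m (\<Union>\<alpha>\<in>F. ?b \<alpha>) = (\<Sum>\<alpha>\<in>F. measure m (?b \<alpha>))"
      using F by (intro finite_measure_finite_Union) (auto simp: borel_m)
    moreover have "mass * \<rho> ^ k \<le> measure m (?b \<alpha>)" for \<alpha>
      using inner_ball_lower[of k "z k \<alpha>"] by (simp add: emeasure_eq_measure)
    then have "(\<Sum>\<alpha>\<in>F. mass * \<rho> ^ k) \<le> (\<Sum>\<alpha>\<in>F. measure m (?b \<alpha>))" by (intro sum_mono)
    moreover have "measure m (\<Union>\<alpha>\<in>F. ?b \<alpha>) \<le> measure m (ball x ((R + inner) * \<delta> ^ k))"
    proof (intro finite_measure_mono)
      show "(\<Union>\<alpha>\<in>F. ?b \<alpha>) \<subseteq> ball x ((R + inner) * \<delta> ^ k)"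
      proof (intro UN_least subsetI)
        fix \<alpha> y assume "\<alpha> \<in> F" "y \<in> ?b \<alpha>"
        then have "dist x (z k \<alpha>) \<le> R * \<delta> ^ k" "dist (z k \<alpha>) y < inner * \<delta> ^ k"
          using F assms(2) by auto
        then show "y \<in> ball x ((R + inner) * \<delta> ^ k)"
          using dist_triangle[of x y "z k \<alpha>"] by (simp add: distrib_right)
      qed
    qed (simp add: borel_m)
    moreover have "measure m (ball x ((R + inner) * \<delta> ^ k)) \<le> upper * ((R + inner) * \<delta> ^ k) powr D"
      using assms(3) inner delta by (intro ball_upper) simp
    moreover have "((R + inner) * \<delta> ^ k) powr D = (R + inner) powr D * \<rho> ^ k"
      by (simp add: powr_mult delta_power_powr)
    ultimately have "(real (card F) * mass) * \<rho> ^ k \<le> (upper * (R + inner) powr D) * \<rho> ^ k"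
      by (simp add: mult.assoc)
    then have "real (card F) * mass \<le> upper * (R + inner) powr D" using rho by simp
    then show ?thesis using mass_pos by (simp add: pos_le_divide_eq)
  qed
  \<comment> \<open>The bound holds for finite subfamilies only; an infinite family would contain a
    finite one exceeding it.\<close>
  have "finite S"
  proof (rule ccontr)
    assume "infinite S"
    then obtain F where "F \<subseteq> S" "finite F" "card F = Suc (nat \<lceil>?B\<rceil>)"
      using infinite_arbitrarily_large by metis
    then show False using bound[of F] by linarith
  qed
  then show ?thesis using bound[of S] by blast
qed

text \<open>Packing with \<open>R\<close> so large, depending on \<open>k\<close>, that every centre
  is within reach.\<close>

lemma finite_I: "finite (I k)"
proof -
  fix x :: 'a
  let ?d = "diameter (UNIV :: 'a set)"
  have "dist x (z k \<alpha>) \<le> ?d / \<delta> ^ k * \<delta> ^ k" for \<alpha>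
    using diameter_bounded_bound[of UNIV x "z k \<alpha>"] delta by simp
  then show ?thesis
    using packing[of "I k" k x "?d / \<delta> ^ k"] diameter_pos delta by simp
qed

text \<open>The radius allows for two cell diameters and one jump of length
  \<open>\<delta> ^ k\<close>, as between centres of adjacent cells. The same number bounds how many
  closed cells of a level contain a given point.\<close>

definition overlap :: real where "overlap = upper * (2 * c4 + 1 + inner) powr D / mass"

lemma overlap_pos: "0 < overlap"
  using upper_pos c4_pos inner mass_pos by (simp add: overlap_def)

lemma card_le_overlap:
  assumes "S \<subseteq> I k" "\<And>\<alpha>. \<alpha> \<in> S \<Longrightarrow> dist x (z k \<alpha>) \<le> (2 * c4 + 1) * \<delta> ^ k"
  shows "real (card S) \<le> overlap"
  using packing[OF assms] c4_pos by (simp add: overlap_def)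

definition cap :: real where "cap = upper * (2 * c4) powr D"

lemma cap_pos: "0 < cap"
  using upper_pos c4_pos by (simp add: cap_def)

lemma measure_closure_le:
  assumes "\<alpha> \<in> I k"
  shows "measure m (closure (Q k \<alpha>)) \<le> cap * \<rho> ^ k"
proof -
  \<comment> \<open>Doubling the radius makes the inequality strict, as balls are open.\<close>
  have "closure (Q k \<alpha>) \<subseteq> ball (z k \<alpha>) (2 * c4 * \<delta> ^ k)"
  proof
    fix x assume "x \<in> closure (Q k \<alpha>)"
    then have "dist (z k \<alpha>) x \<le> c4 * \<delta> ^ k"
      using center[OF assms] closure_subset by (intro dist_closure_cell[OF assms]) auto
    moreover have "0 < c4 * \<delta> ^ k" using c4_pos delta_power by simp
    ultimately show "x \<in> ball (z k \<alpha>) (2 * c4 * \<delta> ^ k)" by simp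
  qed
  then have "measure m (closure (Q k \<alpha>)) \<le> measure m (ball (z k \<alpha>) (2 * c4 * \<delta> ^ k))"
    by (intro finite_measure_mono) (simp_all add: borel_m)
  also have "\<dots> \<le> upper * (2 * c4 * \<delta> ^ k) powr D"
    using c4_pos delta by (intro ball_upper) simp
  also have "\<dots> = cap * \<rho> ^ k"
    by (simp add: powr_mult[of "2 * c4"] delta_power_powr cap_def)
  finally show ?thesis .
qed

lemma measure_cell_le: "\<alpha> \<in> I k \<Longrightarrow> measure m (Q k \<alpha>) \<le> cap * \<rho> ^ k"
  using emeasure_closure_cell[of \<alpha> k] measure_closure_le[of \<alpha> k] by (simp add: emeasure_eq_measure)

lemma measure_cell_ge: "\<alpha> \<in> I k \<Longrightarrow> mass * \<rho> ^ k \<le> measure m (Q k \<alpha>)"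
  using cell_lower[of \<alpha> k] by (simp add: emeasure_eq_measure)

lemma measure_closure_ge: "\<alpha> \<in> I k \<Longrightarrow> mass * \<rho> ^ k \<le> measure m (closure (Q k \<alpha>))"
  using emeasure_closure_cell[of \<alpha> k] measure_cell_ge[of \<alpha> k] by (simp add: emeasure_eq_measure)

section \<open>Neighbours and descendants of a cell\<close>

definition adjacent :: "nat \<Rightarrow> 'i \<Rightarrow> 'i \<Rightarrow> bool" where
  "adjacent k \<alpha> \<beta> \<longleftrightarrow> (\<exists>x\<in>Q k \<alpha>. \<exists>y\<in>Q k \<beta>. dist x y \<le> \<delta> ^ k)"

text \<open>By \<open>self_in_nbrs\<close> a cell is among its own neighbours, unlike in the graph:
  this is the horizontal part of the unit ball around \<open>\<beta>\<close>.\<close>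

definition nbrs :: "nat \<Rightarrow> 'i \<Rightarrow> 'i set" where
  "nbrs k \<beta> = {\<alpha> \<in> I k. adjacent k \<alpha> \<beta>}"

definition descendants :: "nat \<Rightarrow> nat \<Rightarrow> 'i \<Rightarrow> 'i set" where
  "descendants l j \<beta> = {\<alpha> \<in> I l. Q l \<alpha> \<subseteq> Q j \<beta>}"

lemma finite_nbrs: "finite (nbrs k \<beta>)" and finite_descendants: "finite (descendants l j \<beta>)"
  by (simp_all add: nbrs_def descendants_def finite_I)

lemma adjacent_sym: "adjacent k \<alpha> \<beta> \<Longrightarrow> adjacent k \<beta> \<alpha>"
  unfolding adjacent_def by (metis dist_commute)

lemma self_in_nbrs: "\<beta> \<in> I k \<Longrightarrow> \<beta> \<in> nbrs k \<beta>"
  using center[of \<beta> k] delta_power[of k] by (force simp: nbrs_def adjacent_def)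

lemma card_nbrs:
  assumes "\<beta> \<in> I k"
  shows "real (card (nbrs k \<beta>)) \<le> overlap"
proof (rule card_le_overlap)
  fix \<alpha> assume "\<alpha> \<in> nbrs k \<beta>"
  then obtain x y where *: "\<alpha> \<in> I k" "x \<in> Q k \<alpha>" "y \<in> Q k \<beta>" "dist x y \<le> \<delta> ^ k"
    by (auto simp: nbrs_def adjacent_def)
  have "dist (z k \<beta>) (z k \<alpha>) \<le> dist (z k \<beta>) y + dist x y + dist x (z k \<alpha>)"
    by (metis add_right_mono dist_commute dist_triangle order_trans)
  also have "\<dots> \<le> c4 * \<delta> ^ k + \<delta> ^ k + c4 * \<delta> ^ k"
    using * assms center by (intro add_mono dist_cell) auto
  finally show "dist (z k \<beta>) (z k \<alpha>) \<le> (2 * c4 + 1) * \<delta> ^ k" by (simp add: algebra_simps)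
qed (auto simp: nbrs_def)

text \<open>The two points witnessing adjacency at level \<open>l\<close> also lie in the ancestors
  of level \<open>j\<close>, where the permitted distance is at least as large. For
  \<open>j = l\<close> the cell is its own ancestor.\<close>

lemma adjacent_ancestor:
  assumes "j \<le> l" "\<alpha> \<in> I l" "adjacent l \<alpha> \<beta>'" "Q l \<beta>' \<subseteq> Q j \<beta>"
  shows "\<exists>\<gamma>\<in>nbrs j \<beta>. Q l \<alpha> \<subseteq> Q j \<gamma>"
proof -
  obtain \<gamma> where \<gamma>: "\<gamma> \<in> I j" "Q l \<alpha> \<subseteq> Q j \<gamma>"
    using ancestor[of j l \<alpha>] assms(1,2) by (cases "j = l") auto
  have "\<delta> ^ l \<le> \<delta> ^ j" using delta assms(1) by (intro power_decreasing) auto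
  then have "adjacent j \<gamma> \<beta>"
    using assms(3,4) \<gamma>(2) unfolding adjacent_def by (meson order_trans subsetD)
  then show ?thesis using \<gamma> by (auto simp: nbrs_def)
qed

lemma sum_indicator_cells:
  fixes c :: "'i \<Rightarrow> real"
  assumes "\<beta> \<in> I k" "x \<in> Q k \<beta>"
  shows "(\<Sum>\<alpha>\<in>I k. c \<alpha> * indicator (Q k \<alpha>) x) = c \<beta>"
proof -
  have "(\<Sum>\<alpha>\<in>I k. c \<alpha> * indicator (Q k \<alpha>) x) = (\<Sum>\<alpha>\<in>{\<beta>}. c \<alpha> * indicator (Q k \<alpha>) x)"
  proof (intro sum.mono_neutral_right finite_I ballI)
    fix \<alpha> assume \<alpha>: "\<alpha> \<in> I k - {\<beta>}"
    then have "x \<notin> Q k \<alpha>" using cell_unique[of \<alpha> k \<beta> x] assms by blast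
    then show "c \<alpha> * indicator (Q k \<alpha>) x = 0" by simp
  qed (use assms in simp)
  then show ?thesis using assms by simp
qed

text \<open>\<open>cap\<close> and \<open>mass\<close> come from the two bounds on cell measures,
  the square from counting neighbours and closed cells, and the remaining factor from the geometric
  series.\<close>

definition carleson_const :: "real \<Rightarrow> real" where
  "carleson_const s = cap * overlap\<^sup>2 / ((1 - \<rho> powr (1 - s)) * mass)"

text \<open>The summand 1 accounts for the neighbours at level \<open>k\<close>, the other one for
  the children at level \<open>Suc k\<close>.\<close>

definition sum_const :: "real \<Rightarrow> real" where
  "sum_const s = (1 + overlap / \<rho> powr s) / mass powr s"

definition sup_const :: "real \<Rightarrow> real" where
  "sup_const s = cap powr s * overlap"

lemma carleson_const_pos:
  assumes "s < 1"
  shows "0 < carleson_const s"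
proof -
  have "\<rho> powr (1 - s) < 1"
    using rho assms powr_less_mono2[of "1 - s" \<rho> 1] by simp
  then show ?thesis using cap_pos overlap_pos mass_pos by (simp add: carleson_const_def)
qed

lemma sum_const_pos: "0 < sum_const s"
  using mass_pos overlap_pos rho by (simp add: sum_const_def add_pos_pos)

lemma sup_const_pos: "0 < sup_const s"
  using cap_pos overlap_pos by (simp add: sup_const_def)

text \<open>The root lies in \<open>P_G\<close> of every good point, and its ratio is infinite over
  the finite measure of the space.\<close>

lemma integral_SUP_top:
  assumes \<omega>: "emeasure \<omega> UNIV = top" and q: "0 < q"
  shows "(\<integral>\<^sup>+x. ennpowr (SUP \<alpha>\<in>P_G \<delta> I Q apex x. ratio s \<omega> \<alpha>) q \<partial>m) = top"
proof -
  have apex: "apex \<in> I 0" using I_0 by simp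
  have "0 < emeasure m UNIV" using emeasure_open_pos[of UNIV] by simp
  then have "ennpowr (emeasure m UNIV) s \<noteq> top" "emeasure m UNIV \<noteq> 0"
    using finite_m by (auto simp: ennpowr_def)
  moreover from this have "ratio s \<omega> (0, apex) = top"
    by (simp add: ratio_def cell_def Q_apex \<omega> ennreal_top_divide)
  moreover have "ennpowr (ratio s \<omega> (0, apex)) q * emeasure m (Q 0 apex)
      \<le> (\<integral>\<^sup>+x. ennpowr (SUP \<alpha>\<in>P_G \<delta> I Q apex x. ratio s \<omega> \<alpha>) q \<partial>m)"
    by (intro integral_SUP_lower[OF apex _ q] P_G_cell apex)
  ultimately show ?thesis by (simp add: Q_apex ennreal_top_mult top_unique)
qed

section \<open>Level functions of a finite measure \<omega>\<close>

context
  fixes \<omega> :: "'a measure" and s :: real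
  assumes \<omega>: "sets \<omega> = sets borel" "emeasure \<omega> UNIV \<noteq> top" and s: "0 < s" "s < 1"
begin

definition wt :: "nat \<Rightarrow> 'i \<Rightarrow> real" where "wt k \<alpha> = measure \<omega> (closure (Q k \<alpha>))"

definition nbr_wt :: "nat \<Rightarrow> 'i \<Rightarrow> real" where "nbr_wt k \<beta> = (\<Sum>\<alpha>\<in>nbrs k \<beta>. wt k \<alpha>)"

text \<open>The denominator uses the comparable quantity \<open>\<rho> ^ k\<close> in place of the
  measures of the individual closed cells.\<close>

definition coef :: "nat \<Rightarrow> 'i \<Rightarrow> real" where "coef k \<beta> = nbr_wt k \<beta> / (\<rho> ^ k) powr s"

text \<open>The function g k of the overview, written as a simple function; it is 0 on the null set
  outside the cells of level \<open>k\<close>.\<close>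

definition level_fun :: "nat \<Rightarrow> 'a \<Rightarrow> real" where
  "level_fun k x = (\<Sum>\<beta>\<in>I k. coef k \<beta> * indicator (Q k \<beta>) x)"

lemma wt_nonneg: "0 \<le> wt k \<alpha>" by (simp add: wt_def)

lemma nbr_wt_nonneg: "0 \<le> nbr_wt k \<alpha>" by (simp add: nbr_wt_def sum_nonneg wt_nonneg)

lemma coef_nonneg: "0 \<le> coef k \<alpha>" by (simp add: coef_def nbr_wt_nonneg)

lemma level_fun_nonneg: "0 \<le> level_fun k x"
  by (simp add: level_fun_def sum_nonneg coef_nonneg)

lemma level_fun_eq: "\<beta> \<in> I k \<Longrightarrow> x \<in> Q k \<beta> \<Longrightarrow> level_fun k x = coef k \<beta>"
  unfolding level_fun_def by (rule sum_indicator_cells)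

lemma level_fun_const:
  assumes "i \<le> j" "\<beta> \<in> I j" "x \<in> Q j \<beta>" "y \<in> Q j \<beta>"
  shows "level_fun i x = level_fun i y"
proof -
  obtain \<gamma> where "\<gamma> \<in> I i" "Q j \<beta> \<subseteq> Q i \<gamma>"
    using ancestor[of i j \<beta>] assms(1,2) by (cases "i = j") auto
  moreover from this have "x \<in> Q i \<gamma>" "y \<in> Q i \<gamma>" using assms by blast+
  ultimately show ?thesis by (simp add: level_fun_eq)
qed

lemma simple_level_fun: "simple_function m (level_fun k)"
  unfolding level_fun_def
  by (intro simple_function_sum simple_function_mult simple_function_indicator sets_m_open open_Q) auto

lemma finite_measure_\<omega>: "finite_measure \<omega>"
  using \<omega>(2) sets_eq_imp_space_eq[OF \<omega>(1)] by (intro finite_measureI) simp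

text \<open>\<omega> may charge boundaries of cells, so weights of closed cells need not add up.
  Integrating the number of closed cells through a point, which is at most \<open>overlap\<close>,
  replaces additivity.\<close>

lemma sum_wt_descendants_le:
  assumes "j \<le> l" "\<gamma> \<in> I j"
  shows "(\<Sum>\<alpha>\<in>descendants l j \<gamma>. wt l \<alpha>) \<le> overlap * wt j \<gamma>"
proof -
  interpret \<omega>: finite_measure \<omega> by (rule finite_measure_\<omega>)
  let ?S = "descendants l j \<gamma>"
  have [simp]: "closure A \<in> sets \<omega>" for A by (simp add: \<omega>(1))
  have [simp]: "space \<omega> = UNIV" using sets_eq_imp_space_eq[OF \<omega>(1)] by simp
  have int: "integrable \<omega> (\<lambda>x. indicator (closure A) x :: real)" for A
    by (simp add: \<omega>.emeasure_eq_measure)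
  have "(\<Sum>\<alpha>\<in>?S. wt l \<alpha>) = (\<integral>x. (\<Sum>\<alpha>\<in>?S. indicator (closure (Q l \<alpha>)) x) \<partial>\<omega>)"
    by (simp add: wt_def int)
  also have "\<dots> \<le> (\<integral>x. overlap * indicator (closure (Q j \<gamma>)) x \<partial>\<omega>)"
  proof (intro integral_mono Bochner_Integration.integrable_sum integrable_mult_right int)
    fix x
    let ?T = "{\<alpha> \<in> ?S. x \<in> closure (Q l \<alpha>)}"
    have "(\<Sum>\<alpha>\<in>?S. indicator (closure (Q l \<alpha>)) x) = (\<Sum>\<alpha>\<in>?T. 1 :: real)"
      using finite_descendants by (intro sum.mono_neutral_cong_right) (auto simp: indicator_def)
    also have "\<dots> = real (card ?T)" by simp
    also have "\<dots> \<le> overlap * indicator (closure (Q j \<gamma>)) x"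
    proof (cases "x \<in> closure (Q j \<gamma>)")
      case True
      have "real (card ?T) \<le> overlap"
      proof (rule card_le_overlap)
        show "?T \<subseteq> I l" by (auto simp: descendants_def)
        fix \<alpha> assume \<alpha>: "\<alpha> \<in> ?T"
        then have "\<alpha> \<in> I l" by (auto simp: descendants_def)
        then have "dist x (z l \<alpha>) \<le> c4 * \<delta> ^ l"
          using \<alpha> center closure_subset by (intro dist_closure_cell) auto
        also have "\<dots> \<le> (2 * c4 + 1) * \<delta> ^ l"
          using c4_pos delta by (intro mult_right_mono) auto
        finally show "dist x (z l \<alpha>) \<le> (2 * c4 + 1) * \<delta> ^ l" .
      qed
      then show ?thesis using True by simp
    next
      case False
      then have "?T = {}"
        using closure_mono[of "Q l \<alpha>" "Q j \<gamma>" for \<alpha>] by (auto simp: descendants_def)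
      then have "real (card ?T) = 0" by (simp only: card.empty of_nat_0)
      then show ?thesis using overlap_pos by simp
    qed
    finally show "(\<Sum>\<alpha>\<in>?S. indicator (closure (Q l \<alpha>)) x)
      \<le> overlap * indicator (closure (Q j \<gamma>)) x" .
  qed
  also have "\<dots> = overlap * wt j \<gamma>" by (simp add: wt_def)
  finally show ?thesis .
qed

text \<open>Double counting: each cell \<open>\<alpha>\<close> of level \<open>l\<close> neighbours
  at most \<open>overlap\<close> descendants of \<open>\<beta>\<close>, and if it neighbours any,
  its ancestor of level \<open>j\<close> neighbours \<open>\<beta>\<close>. The second factor
  \<open>overlap\<close> comes from \<open>sum_wt_descendants_le\<close>.\<close>

lemma sum_nbr_wt_descendants_le:
  assumes "j \<le> l" "\<beta> \<in> I j"
  shows "(\<Sum>\<beta>'\<in>descendants l j \<beta>. nbr_wt l \<beta>') \<le> overlap\<^sup>2 * nbr_wt j \<beta>"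
proof -
  let ?T = "descendants l j \<beta>"
  have "(\<Sum>\<beta>'\<in>?T. nbr_wt l \<beta>') = (\<Sum>\<beta>'\<in>?T. \<Sum>\<alpha>\<in>{\<alpha>\<in>I l. adjacent l \<alpha> \<beta>'}. wt l \<alpha>)"
    by (simp add: nbr_wt_def nbrs_def)
  also have "\<dots> = (\<Sum>\<alpha>\<in>I l. \<Sum>\<beta>'\<in>{\<beta>'\<in>?T. adjacent l \<alpha> \<beta>'}. wt l \<alpha>)"
    by (intro sum.swap_restrict finite_descendants finite_I)
  also have "\<dots> \<le> (\<Sum>\<alpha>\<in>I l. overlap * (\<Sum>\<gamma>\<in>{\<gamma>\<in>nbrs j \<beta>. Q l \<alpha> \<subseteq> Q j \<gamma>}. wt l \<alpha>))"
  proof (rule sum_mono)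
    fix \<alpha> assume \<alpha>: "\<alpha> \<in> I l"
    let ?A = "{\<beta>'\<in>?T. adjacent l \<alpha> \<beta>'}" and ?B = "{\<gamma>\<in>nbrs j \<beta>. Q l \<alpha> \<subseteq> Q j \<gamma>}"
    \<comment> \<open>If \<open>?A\<close> is nonempty, \<open>adjacent_ancestor\<close> makes
      \<open>?B\<close> nonempty, so its cardinality is at least 1.\<close>
    have "real (card ?A) \<le> overlap * real (card ?B)"
    proof (cases "?A = {}")
      case False
      have "card ?A \<le> card (nbrs l \<alpha>)"
        using adjacent_sym by (intro card_mono finite_nbrs) (auto simp: nbrs_def descendants_def)
      then have "real (card ?A) \<le> overlap" using card_nbrs[OF \<alpha>] by linarith
      moreover have "?B \<noteq> {}"
        using False adjacent_ancestor[OF assms(1) \<alpha>, of _ \<beta>] by (fastforce simp: descendants_def)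
      then have "1 \<le> card ?B" using finite_nbrs by (simp add: Suc_le_eq card_gt_0_iff)
      then have "overlap * 1 \<le> overlap * real (card ?B)"
        using overlap_pos by (intro mult_left_mono) linarith+
      ultimately show ?thesis by simp
    next
      case True
      then show ?thesis using overlap_pos by (simp only: card.empty) simp
    qed
    then show "(\<Sum>\<beta>'\<in>?A. wt l \<alpha>) \<le> overlap * (\<Sum>\<gamma>\<in>?B. wt l \<alpha>)"
      using mult_right_mono[of "real (card ?A)" "overlap * real (card ?B)" "wt l \<alpha>"] wt_nonneg
      by (simp add: mult.assoc)
  qed
  also have "\<dots> = overlap * (\<Sum>\<gamma>\<in>nbrs j \<beta>. \<Sum>\<alpha>\<in>descendants l j \<gamma>. wt l \<alpha>)"
    unfolding descendants_def sum_distrib_left[symmetric]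
    using sum.swap_restrict[OF finite_nbrs[of j \<beta>] finite_I[of l],
        of "\<lambda>\<gamma> \<alpha>. wt l \<alpha>" "\<lambda>\<gamma> \<alpha>. Q l \<alpha> \<subseteq> Q j \<gamma>"] by simp
  also have "\<dots> \<le> overlap * (\<Sum>\<gamma>\<in>nbrs j \<beta>. overlap * wt j \<gamma>)"
    using overlap_pos assms(1)
    by (intro mult_left_mono sum_mono sum_wt_descendants_le) (auto simp: nbrs_def)
  also have "\<dots> = overlap\<^sup>2 * nbr_wt j \<beta>"
    by (simp add: nbr_wt_def sum_distrib_left power2_eq_square mult.assoc)
  finally show ?thesis .
qed

section \<open>The Carleson condition for the level functions\<close>

abbreviation \<theta> :: real where "\<theta> \<equiv> \<rho> powr (1 - s)"

lemma theta: "0 < \<theta>" "\<theta> < 1"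
  using rho s powr_less_mono2[of "1 - s" \<rho> 1] by auto

text \<open>The measure scale of a cell divided by the normalisation in \<open>coef\<close>. As
  \<open>s < 1\<close>, this decays geometrically in the level.\<close>

lemma theta_power: "\<theta> ^ k = \<rho> ^ k / (\<rho> ^ k) powr s"
proof -
  have "\<theta> ^ k = (\<rho> ^ k) powr (1 - s)"
    using rho by (simp add: powr_realpow[symmetric] powr_powr mult.commute)
  then show ?thesis using rho by (simp add: powr_diff)
qed

lemma integral_level_fun_cell:
  assumes "j \<le> l" "\<beta> \<in> I j"
  shows "(\<integral>x. level_fun l x * indicator (Q j \<beta>) x \<partial>m) \<le> cap * overlap\<^sup>2 * nbr_wt j \<beta> * \<theta> ^ l"
proof -
  have "level_fun l x * indicator (Q j \<beta>) x
      = (\<Sum>\<beta>'\<in>descendants l j \<beta>. coef l \<beta>' * indicator (Q l \<beta>') x)" for x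
  proof -
    have "level_fun l x * indicator (Q j \<beta>) x
        = (\<Sum>\<beta>'\<in>I l. coef l \<beta>' * indicator (Q l \<beta>') x * indicator (Q j \<beta>) x)"
      by (simp add: level_fun_def sum_distrib_right)
    also have "\<dots> = (\<Sum>\<beta>'\<in>descendants l j \<beta>. coef l \<beta>' * indicator (Q l \<beta>') x)"
      using nested[OF assms] finite_I
      by (intro sum.mono_neutral_cong_right) (auto simp: descendants_def indicator_def)
    finally show ?thesis .
  qed
  then have "(\<integral>x. level_fun l x * indicator (Q j \<beta>) x \<partial>m)
      = (\<integral>x. (\<Sum>\<beta>'\<in>descendants l j \<beta>. coef l \<beta>' * indicator (Q l \<beta>') x) \<partial>m)" by simp
  also have "\<dots> = (\<Sum>\<beta>'\<in>descendants l j \<beta>. coef l \<beta>' * measure m (Q l \<beta>'))"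
    by (subst Bochner_Integration.integral_sum)
      (auto simp: descendants_def emeasure_eq_measure intro!: integrable_mult_right sets_m_open open_Q)
  also have "\<dots> \<le> (\<Sum>\<beta>'\<in>descendants l j \<beta>. coef l \<beta>' * (cap * \<rho> ^ l))"
    by (intro sum_mono mult_left_mono measure_cell_le coef_nonneg) (auto simp: descendants_def)
  also have "\<dots> = cap * \<theta> ^ l * (\<Sum>\<beta>'\<in>descendants l j \<beta>. nbr_wt l \<beta>')"
    by (simp add: coef_def theta_power sum_distrib_left sum_divide_distrib mult_ac)
  also have "\<dots> \<le> cap * \<theta> ^ l * (overlap\<^sup>2 * nbr_wt j \<beta>)"
    using cap_pos theta assms by (intro mult_left_mono sum_nbr_wt_descendants_le) auto
  finally show ?thesis by (simp add: mult_ac)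
qed

lemma integrable_simple: "simple_function m f \<Longrightarrow> integrable m f" for f :: "'a \<Rightarrow> real"
  by (rule integrable_simple_function_real)

lemma simple_indicator_cell: "\<beta> \<in> I j \<Longrightarrow> simple_function m (indicator (Q j \<beta>) :: 'a \<Rightarrow> real)"
  by (intro simple_function_indicator sets_m_open open_Q)

lemma Carleson_cell:
  assumes \<beta>: "\<beta> \<in> I j" and "j \<le> n"
  shows "(\<integral>x. (\<Sum>k=j..n. level_fun k x) * indicator (Q j \<beta>) x \<partial>m)
    \<le> carleson_const s * (coef j \<beta> * measure m (Q j \<beta>))"
proof -
  let ?K = "cap * overlap\<^sup>2 * nbr_wt j \<beta>"
  have K: "0 \<le> ?K" using cap_pos nbr_wt_nonneg by simp
  have "simple_function m (\<lambda>x. level_fun k x * indicator (Q j \<beta>) x)" for k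
    by (intro simple_function_mult simple_level_fun simple_indicator_cell \<beta>)
  then have "(\<integral>x. (\<Sum>k=j..n. level_fun k x) * indicator (Q j \<beta>) x \<partial>m)
      = (\<Sum>k=j..n. \<integral>x. level_fun k x * indicator (Q j \<beta>) x \<partial>m)"
    unfolding sum_distrib_right by (intro Bochner_Integration.integral_sum integrable_simple)
  also have "\<dots> \<le> (\<Sum>k=j..n. ?K * \<theta> ^ k)"
    by (intro sum_mono integral_level_fun_cell \<beta>) simp
  also have "\<dots> = ?K * (\<Sum>k=j..n. \<theta> ^ k)" by (simp add: sum_distrib_left)
  also have "\<dots> \<le> ?K * (\<theta> ^ j / (1 - \<theta>))"
  proof (intro mult_left_mono K)
    have "(1 - \<theta>) * (\<Sum>k=j..n. \<theta> ^ k) \<le> \<theta> ^ j"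
      using sum_gp_multiplied[OF \<open>j \<le> n\<close>, of \<theta>] theta by simp
    then show "(\<Sum>k=j..n. \<theta> ^ k) \<le> \<theta> ^ j / (1 - \<theta>)"
      using theta by (simp add: pos_le_divide_eq mult.commute)
  qed
  \<comment> \<open>\<open>nbr_wt j \<beta> * \<theta> ^ j\<close> equals
    \<open>coef j \<beta> * \<rho> ^ j\<close>, so that the lower bound on cell measures applies
    next.\<close>
  also have "\<dots> = carleson_const s * (coef j \<beta> * (mass * \<rho> ^ j))"
    using mass_pos theta by (simp add: carleson_const_def coef_def theta_power mult_ac)
  also have "\<dots> \<le> carleson_const s * (coef j \<beta> * measure m (Q j \<beta>))"
    using cap_pos mass_pos theta
    by (intro mult_left_mono measure_cell_ge \<beta> coef_nonneg) (simp add: carleson_const_def)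
  finally show ?thesis .
qed

text \<open>The cells of level \<open>j\<close> cover almost everything, and on each of them
  \<open>h\<close> equals its value at the distinguished point.\<close>

lemma integral_level_const:
  fixes h u :: "'a \<Rightarrow> real"
  assumes h: "simple_function m h" and u: "simple_function m u"
    and const: "\<And>\<beta> x y. \<beta> \<in> I j \<Longrightarrow> x \<in> Q j \<beta> \<Longrightarrow> y \<in> Q j \<beta> \<Longrightarrow> h x = h y"
  shows "(\<integral>x. h x * u x \<partial>m)
    = (\<Sum>\<beta>\<in>I j. h (z j \<beta>) * (\<integral>x. u x * indicator (Q j \<beta>) x \<partial>m))"
proof -
  have simple: "simple_function m (\<lambda>x. u x * indicator (Q j \<beta>) x)" if "\<beta> \<in> I j" for \<beta>
    using that by (intro simple_function_mult u simple_indicator_cell)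
  have int: "integrable m (\<lambda>x. h (z j \<beta>) * (u x * indicator (Q j \<beta>) x))" if "\<beta> \<in> I j" for \<beta>
    using simple[OF that] by (intro integrable_mult_right integrable_simple)
  have "(\<integral>x. h x * u x \<partial>m)
      = (\<integral>x. (\<Sum>\<beta>\<in>I j. h (z j \<beta>) * (u x * indicator (Q j \<beta>) x)) \<partial>m)"
  proof (rule integral_cong_AE)
    show "AE x in m. h x * u x = (\<Sum>\<beta>\<in>I j. h (z j \<beta>) * (u x * indicator (Q j \<beta>) x))"
      using AE_good
    proof eventually_elim
      case (elim x)
      note ix = index[OF elim, of j]
      have "(\<Sum>\<beta>\<in>I j. h (z j \<beta>) * u x * indicator (Q j \<beta>) x) = h (z j (index j x)) * u x"
        by (rule sum_indicator_cells[OF ix])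
      moreover have "h (z j (index j x)) = h x"
        using const[OF ix(1) center[OF ix(1)] ix(2)] .
      ultimately show ?case by (simp add: mult.assoc)
    qed
    show "(\<lambda>x. h x * u x) \<in> borel_measurable m"
      using h u by (intro borel_measurable_times borel_measurable_simple_function)
    show "(\<lambda>x. \<Sum>\<beta>\<in>I j. h (z j \<beta>) * (u x * indicator (Q j \<beta>) x)) \<in> borel_measurable m"
      by (intro borel_measurable_integrable Bochner_Integration.integrable_sum int)
  qed
  also have "\<dots> = (\<Sum>\<beta>\<in>I j. \<integral>x. h (z j \<beta>) * (u x * indicator (Q j \<beta>) x) \<partial>m)"
    by (intro Bochner_Integration.integral_sum int)
  finally show ?thesis by simp
qed

text \<open>The hypothesis of the abstract estimate: freeze \<open>h\<close> on each cell of level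
  \<open>j\<close>, apply \<open>Carleson_cell\<close> there and reassemble the integral.\<close>

lemma Carleson_level:
  fixes h :: "'a \<Rightarrow> real"
  assumes "j \<le> n" and h: "simple_function m h" "\<And>x. 0 \<le> h x"
    and const: "\<And>x y. (\<And>i. i \<le> j \<Longrightarrow> level_fun i x = level_fun i y) \<Longrightarrow> h x = h y"
  shows "(\<integral>x. h x * (\<Sum>k=j..n. level_fun k x) \<partial>m)
    \<le> carleson_const s * (\<integral>x. h x * level_fun j x \<partial>m)"
proof -
  have h_const: "h x = h y" if "\<beta> \<in> I j" "x \<in> Q j \<beta>" "y \<in> Q j \<beta>" for \<beta> x y
    using that by (intro const level_fun_const)
  have "(\<integral>x. h x * (\<Sum>k=j..n. level_fun k x) \<partial>m)
      = (\<Sum>\<beta>\<in>I j. h (z j \<beta>) * (\<integral>x. (\<Sum>k=j..n. level_fun k x) * indicator (Q j \<beta>) x \<partial>m))"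
    by (intro integral_level_const[OF h(1) _ h_const] simple_function_sum simple_level_fun)
  also have "\<dots> \<le> (\<Sum>\<beta>\<in>I j. h (z j \<beta>) * (carleson_const s * (coef j \<beta> * measure m (Q j \<beta>))))"
    using assms(1) by (intro sum_mono mult_left_mono Carleson_cell h(2))
  also have "\<dots> = carleson_const s *
      (\<Sum>\<beta>\<in>I j. h (z j \<beta>) * (\<integral>x. level_fun j x * indicator (Q j \<beta>) x \<partial>m))"
  proof -
    have "(\<integral>x. level_fun j x * indicator (Q j \<beta>) x \<partial>m) = coef j \<beta> * measure m (Q j \<beta>)"
      if \<beta>: "\<beta> \<in> I j" for \<beta>
    proof -
      have "(\<integral>x. level_fun j x * indicator (Q j \<beta>) x \<partial>m)
          = (\<integral>x. coef j \<beta> * indicator (Q j \<beta>) x \<partial>m)"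
        using level_fun_eq[OF \<beta>]
        by (intro Bochner_Integration.integral_cong) (simp_all add: indicator_def)
      also have "\<dots> = coef j \<beta> * measure m (Q j \<beta>)" by simp
      finally show ?thesis .
    qed
    then show ?thesis by (simp add: sum_distrib_left mult_ac)
  qed
  also have "(\<Sum>\<beta>\<in>I j. h (z j \<beta>) * (\<integral>x. level_fun j x * indicator (Q j \<beta>) x \<partial>m))
      = (\<integral>x. h x * level_fun j x \<partial>m)"
    by (intro integral_level_const[OF h(1) _ h_const, symmetric] simple_level_fun)
  finally show ?thesis .
qed

text \<open>The supremum is truncated at level \<open>n\<close> so that it remains a simple
  function.\<close>

definition level_max :: "nat \<Rightarrow> 'a \<Rightarrow> real" where
  "level_max n x = Max ((\<lambda>k. level_fun k x) ` {..n})"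

lemma level_max_ge: "k \<le> n \<Longrightarrow> level_fun k x \<le> level_max n x"
  by (simp add: level_max_def)

lemma simple_level_max: "simple_function m (level_max n)"
proof (induction n)
  case 0
  then show ?case using simple_level_fun[of 0] by (simp add: level_max_def[abs_def])
next
  case (Suc n)
  have "level_max (Suc n) = (\<lambda>x. max (level_fun (Suc n) x) (level_max n x))"
    by (simp add: level_max_def[abs_def] atMost_Suc)
  then show ?case using simple_function_max[OF simple_level_fun Suc.IH] by simp
qed

lemma sum_level_fun_powr_bound:
  assumes "1 \<le> q"
  shows "(\<integral>x. (\<Sum>k\<le>n. level_fun k x) powr q \<partial>m)
    \<le> (2 * q * carleson_const s) powr q * (\<integral>x. level_max n x powr q \<partial>m)"
proof (rule Carleson_sum_powr_bound[OF simple_level_fun simple_level_max level_fun_nonneg level_max_ge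
      assms carleson_const_pos[OF s(2)]])
  fix j and h :: "'a \<Rightarrow> real"
  assume "j \<le> n" "simple_function m h" "\<And>x. 0 \<le> h x"
    and "\<And>x y. (\<And>i. i \<le> j \<Longrightarrow> level_fun i x = level_fun i y) \<Longrightarrow> h x = h y"
  then show "(\<integral>x. h x * (\<Sum>k=j..n. level_fun k x) \<partial>m)
      \<le> carleson_const s * (\<integral>x. h x * level_fun j x \<partial>m)"
    by (rule Carleson_level) blast
qed

section \<open>Comparing the ratios over \<open>P_G\<close> with the level functions\<close>

lemma ratio_eq:
  assumes "\<alpha> \<in> I k"
  shows "ratio s \<omega> (k, \<alpha>) = ennreal (wt k \<alpha> / measure m (closure (Q k \<alpha>)) powr s)"
proof -
  interpret \<omega>: finite_measure \<omega> by (rule finite_measure_\<omega>)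
  have "0 < mass * \<rho> ^ k" using mass_pos rho by simp
  then have "0 < measure m (closure (Q k \<alpha>))" using measure_closure_ge[OF assms] by linarith
  then show ?thesis
    by (simp add: ratio_def cell_def wt_def \<omega>.emeasure_eq_measure emeasure_eq_measure
        ennpowr_ennreal divide_ennreal)
qed

lemma nbrs_subset_P_G:
  assumes "x \<in> good" "\<alpha> \<in> nbrs k (index k x)"
  shows "(k, \<alpha>) \<in> P_G \<delta> I Q apex x"
  unfolding P_G_good[OF assms(1)] using assms index[OF assms(1), of k]
  by (auto simp: nbrs_def adjacent_def graph_edges_def vertices_iff ray_def level_def cell_def
      intro!: exI[of _ k])

text \<open>Neighbours and children of the ray vertex at level \<open>k\<close>. Its parent is
  omitted, being itself on the ray and hence in the star one level up.\<close>

definition star :: "nat \<Rightarrow> 'a \<Rightarrow> 'i vertex set" where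
  "star k x = Pair k ` nbrs k (index k x) \<union> Pair (Suc k) ` descendants (Suc k) k (index k x)"

lemma P_G_subset_star:
  assumes "x \<in> good"
  shows "P_G \<delta> I Q apex x \<subseteq> (\<Union>k. star k x)"
proof
  fix \<alpha> assume "\<alpha> \<in> P_G \<delta> I Q apex x"
  then obtain n where v: "\<alpha> \<in> vertices I" and "\<alpha> = ray x n \<or> (\<alpha>, ray x n) \<in> graph_edges \<delta> I Q"
    unfolding P_G_good[OF assms] by blast
  obtain k \<gamma> where \<alpha>: "\<alpha> = (k, \<gamma>)" "\<gamma> \<in> I k" using v by (cases \<alpha>) (auto simp: vertices_iff)
  note ix = index[OF assms]
  consider "\<alpha> = ray x n"
    | "k = n" "adjacent n \<gamma> (index n x)"
    | "n = Suc k" "Q n (index n x) \<subseteq> Q k \<gamma>"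
    | "k = Suc n" "Q k \<gamma> \<subseteq> Q n (index n x)"
    using \<open>\<alpha> = ray x n \<or> _\<close> \<alpha>
    by (auto simp: graph_edges_def tree_edges_def ray_def level_def cell_def adjacent_def)
  then show "\<alpha> \<in> (\<Union>k. star k x)"
  proof cases
    case 1
    then show ?thesis using self_in_nbrs[OF ix(1)] by (auto simp: star_def ray_def)
  next
    case 2
    then have "\<alpha> \<in> star n x" using \<alpha> by (simp add: star_def nbrs_def)
    then show ?thesis by blast
  next
    case 3
    then have "index k x = \<gamma>" using ix(2)[of n] \<alpha>(2) by (intro index_eq) auto
    then have "\<alpha> \<in> star k x" using \<alpha> self_in_nbrs by (simp add: star_def)
    then show ?thesis by blast
  next
    case 4
    then have "\<alpha> \<in> star n x" using \<alpha> by (simp add: star_def descendants_def)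
    then show ?thesis by blast
  qed
qed

definition bound :: "'i vertex \<Rightarrow> real" where
  "bound \<alpha> = wt (fst \<alpha>) (snd \<alpha>) / (mass * \<rho> ^ fst \<alpha>) powr s"

lemma bound_nonneg: "0 \<le> bound \<alpha>" by (simp add: bound_def wt_nonneg)

lemma ratio_le_bound:
  assumes "\<alpha> \<in> vertices I"
  shows "ratio s \<omega> \<alpha> \<le> ennreal (bound \<alpha>)"
proof -
  obtain k \<gamma> where \<alpha>: "\<alpha> = (k, \<gamma>)" "\<gamma> \<in> I k" using assms by (cases \<alpha>) (auto simp: vertices_iff)
  have "0 < mass * \<rho> ^ k" using mass_pos rho by simp
  then have "wt k \<gamma> / measure m (closure (Q k \<gamma>)) powr s \<le> wt k \<gamma> / (mass * \<rho> ^ k) powr s"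
    using measure_closure_ge[OF \<alpha>(2)] s wt_nonneg rho
    by (intro divide_left_mono powr_mono2 mult_pos_pos) auto
  then show ?thesis using \<alpha> by (simp add: ratio_eq bound_def ennreal_leI)
qed

text \<open>The neighbours give \<open>level_fun\<close> up to \<open>mass powr s\<close>. The
  weights of the children sum to at most \<open>overlap\<close> times that of their parent, and
  their denominators differ by the factor \<open>\<rho> powr s\<close>.\<close>

lemma sum_star_bound_le:
  assumes "x \<in> good"
  shows "finite (star k x)" "(\<Sum>\<alpha>\<in>star k x. bound \<alpha>) \<le> sum_const s * level_fun k x"
proof -
  let ?i = "index k x"
  note ix = index[OF assms, of k]
  show "finite (star k x)" by (simp add: star_def finite_nbrs finite_descendants)
  have pos: "0 < mass powr s" "0 < \<rho> powr s" "0 < (\<rho> ^ k) powr s" using mass_pos rho by auto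
  have "(\<Sum>\<alpha>\<in>star k x. bound \<alpha>) = (\<Sum>\<alpha>\<in>Pair k ` nbrs k ?i. bound \<alpha>)
      + (\<Sum>\<alpha>\<in>Pair (Suc k) ` descendants (Suc k) k ?i. bound \<alpha>)"
    unfolding star_def by (intro sum.union_disjoint) (auto simp: finite_nbrs finite_descendants)
  also have "(\<Sum>\<alpha>\<in>Pair k ` nbrs k ?i. bound \<alpha>) = level_fun k x / mass powr s"
    by (subst sum.reindex)
      (simp_all add: level_fun_eq[OF ix] bound_def coef_def nbr_wt_def sum_divide_distrib powr_mult
        inj_on_def mult.commute)
  also have "(\<Sum>\<alpha>\<in>Pair (Suc k) ` descendants (Suc k) k ?i. bound \<alpha>)
      = (\<Sum>\<alpha>\<in>descendants (Suc k) k ?i. wt (Suc k) \<alpha>) / (mass powr s * \<rho> powr s * (\<rho> ^ k) powr s)"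
    by (subst sum.reindex)
      (simp_all add: bound_def sum_divide_distrib powr_mult inj_on_def mult.assoc)
  also have "\<dots> \<le> overlap * wt k ?i / (mass powr s * \<rho> powr s * (\<rho> ^ k) powr s)"
    using ix by (intro divide_right_mono sum_wt_descendants_le) auto
  also have "\<dots> \<le> overlap * nbr_wt k ?i / (mass powr s * \<rho> powr s * (\<rho> ^ k) powr s)"
  proof (intro divide_right_mono mult_left_mono)
    show "wt k ?i \<le> nbr_wt k ?i"
      unfolding nbr_wt_def
      by (rule member_le_sum[OF self_in_nbrs[OF ix(1)] wt_nonneg finite_nbrs])
  qed (use overlap_pos in auto)
  also have "\<dots> = overlap / \<rho> powr s * level_fun k x / mass powr s"
    by (simp add: level_fun_eq[OF ix] coef_def mult_ac)
  also have "level_fun k x / mass powr s + overlap / \<rho> powr s * level_fun k x / mass powr s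
      = sum_const s * level_fun k x"
    by (simp add: sum_const_def algebra_simps add_divide_distrib)
  finally show "(\<Sum>\<alpha>\<in>star k x. bound \<alpha>) \<le> sum_const s * level_fun k x" by simp
qed

lemma infsum_ratio_le:
  assumes x: "x \<in> good"
  shows "(\<Sum>\<^sub>\<infinity>\<alpha>\<in>P_G \<delta> I Q apex x. ratio s \<omega> \<alpha>)
    \<le> (SUP n. ennreal (sum_const s * (\<Sum>k\<le>n. level_fun k x)))"
proof (rule infsum_le_finite_sums)
  show "ratio s \<omega> summable_on P_G \<delta> I Q apex x" by (rule nonneg_summable_on_complete) simp
  fix F assume F: "finite F" "F \<subseteq> P_G \<delta> I Q apex x"
  then have "\<forall>\<alpha>\<in>F. \<exists>k. \<alpha> \<in> star k x" using P_G_subset_star[OF x] by blast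
  then obtain f where f: "\<And>\<alpha>. \<alpha> \<in> F \<Longrightarrow> \<alpha> \<in> star (f \<alpha>) x" by metis
  obtain n where n: "\<And>\<alpha>. \<alpha> \<in> F \<Longrightarrow> f \<alpha> \<le> n"
    using F(1) finite_nat_set_iff_bounded_le[of "f ` F"] by auto
  have "(\<Sum>\<alpha>\<in>F. ratio s \<omega> \<alpha>) \<le> (\<Sum>\<alpha>\<in>F. ennreal (bound \<alpha>))"
    using F(2) by (intro sum_mono ratio_le_bound) (auto simp: P_G_def)
  also have "\<dots> = ennreal (\<Sum>\<alpha>\<in>F. bound \<alpha>)" by (simp add: bound_nonneg)
  \<comment> \<open>Stars of consecutive levels may overlap; counting a vertex once for each star
    containing it only increases the sum.\<close>
  also have "(\<Sum>\<alpha>\<in>F. bound \<alpha>) \<le> (\<Sum>\<alpha>\<in>F. \<Sum>k\<in>{k\<in>{..n}. \<alpha> \<in> star k x}. bound \<alpha>)"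
  proof (rule sum_mono)
    fix \<alpha> assume "\<alpha> \<in> F"
    then show "bound \<alpha> \<le> (\<Sum>k\<in>{k\<in>{..n}. \<alpha> \<in> star k x}. bound \<alpha>)"
      using f n bound_nonneg by (intro member_le_sum[of "f \<alpha>" _ "\<lambda>_. bound \<alpha>"]) auto
  qed
  also have "\<dots> = (\<Sum>k\<le>n. \<Sum>\<alpha>\<in>{\<alpha>\<in>F. \<alpha> \<in> star k x}. bound \<alpha>)"
    by (rule sum.swap_restrict) (use F in auto)
  also have "\<dots> \<le> (\<Sum>k\<le>n. \<Sum>\<alpha>\<in>star k x. bound \<alpha>)"
    by (intro sum_mono sum_mono2 sum_star_bound_le(1)[OF x] bound_nonneg) auto
  also have "\<dots> \<le> (\<Sum>k\<le>n. sum_const s * level_fun k x)"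
    by (intro sum_mono sum_star_bound_le(2)[OF x])
  also have "\<dots> = sum_const s * (\<Sum>k\<le>n. level_fun k x)" by (simp add: sum_distrib_left)
  finally show "(\<Sum>\<alpha>\<in>F. ratio s \<omega> \<alpha>)
      \<le> (SUP n. ennreal (sum_const s * (\<Sum>k\<le>n. level_fun k x)))"
    by (rule order_trans[OF _ SUP_upper]) (auto intro: ennreal_leI)
qed

text \<open>All neighbours of the ray vertex lie in \<open>P_G\<close>, there are at most
  \<open>overlap\<close> of them, and \<open>cap\<close> converts measures of closed cells into
  \<open>\<rho> ^ k\<close>.\<close>

lemma level_fun_le_SUP:
  assumes x: "x \<in> good"
  shows "ennreal (level_fun k x / sup_const s) \<le> (SUP \<alpha>\<in>P_G \<delta> I Q apex x. ratio s \<omega> \<alpha>)"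
    (is "_ \<le> ?S")
proof (cases ?S)
  case (real t)
  note ix = index[OF x, of k]
  have "wt k \<alpha> / (\<rho> ^ k) powr s \<le> cap powr s * t" if \<alpha>: "\<alpha> \<in> nbrs k (index k x)" for \<alpha>
  proof -
    have \<alpha>I: "\<alpha> \<in> I k" using \<alpha> by (simp add: nbrs_def)
    let ?c = "measure m (closure (Q k \<alpha>))"
    have "ratio s \<omega> (k, \<alpha>) \<le> ?S" by (intro SUP_upper nbrs_subset_P_G x \<alpha>)
    then have le: "wt k \<alpha> / ?c powr s \<le> t" using real by (simp add: ratio_eq[OF \<alpha>I])
    have "0 < mass * \<rho> ^ k" using mass_pos rho by simp
    then have c: "0 < ?c" using measure_closure_ge[OF \<alpha>I] by linarith
    have "?c powr s \<le> (cap * \<rho> ^ k) powr s"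
      using measure_closure_le[OF \<alpha>I] c s by (intro powr_mono2) auto
    also have "\<dots> = cap powr s * (\<rho> ^ k) powr s" by (simp add: powr_mult)
    finally have "?c powr s * t \<le> cap powr s * (\<rho> ^ k) powr s * t"
      using real by (intro mult_right_mono) auto
    moreover have "wt k \<alpha> \<le> ?c powr s * t" using le c by (simp add: pos_divide_le_eq mult.commute)
    ultimately show ?thesis using rho by (simp add: pos_divide_le_eq mult_ac)
  qed
  then have "level_fun k x \<le> (\<Sum>\<alpha>\<in>nbrs k (index k x). cap powr s * t)"
    unfolding level_fun_eq[OF ix] coef_def nbr_wt_def sum_divide_distrib by (intro sum_mono)
  also have "\<dots> = real (card (nbrs k (index k x))) * (cap powr s * t)" by simp
  also have "\<dots> \<le> overlap * (cap powr s * t)"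
    using real by (intro mult_right_mono card_nbrs ix) auto
  also have "\<dots> = sup_const s * t" by (simp add: sup_const_def)
  finally have "level_fun k x / sup_const s \<le> t"
    using sup_const_pos by (simp add: pos_divide_le_eq mult.commute)
  then show ?thesis using real by (simp add: ennreal_leI)
next
  case top
  show ?thesis unfolding top by simp
qed

lemma level_max_powr_le_SUP:
  assumes x: "x \<in> good" and q: "0 < q"
  shows "ennreal ((level_max n x / sup_const s) powr q)
    \<le> ennpowr (SUP \<alpha>\<in>P_G \<delta> I Q apex x. ratio s \<omega> \<alpha>) q"
proof -
  have "level_max n x \<in> (\<lambda>k. level_fun k x) ` {..n}"
    unfolding level_max_def by (intro Max_in) auto
  then obtain k where k: "level_max n x = level_fun k x" by blast
  have "ennpowr (ennreal (level_fun k x / sup_const s)) q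
      \<le> ennpowr (SUP \<alpha>\<in>P_G \<delta> I Q apex x. ratio s \<omega> \<alpha>) q"
    using x q by (intro ennpowr_mono level_fun_le_SUP)
  then show ?thesis using level_fun_nonneg sup_const_pos by (simp add: k ennpowr_ennreal less_imp_le)
qed

text \<open>The three factors arise from passing to level functions, from the abstract estimate, and
  from returning to the supremum. The bound for partial sums is uniform in \<open>n\<close>, so
  monotone convergence finishes the argument.\<close>

lemma finite_measure_bound:
  assumes q: "1 \<le> q"
  shows "(\<integral>\<^sup>+x. ennpowr (\<Sum>\<^sub>\<infinity>\<alpha>\<in>P_G \<delta> I Q apex x. ratio s \<omega> \<alpha>) q \<partial>m)
    \<le> ennreal ((sum_const s * (2 * q * carleson_const s) * sup_const s) powr q)
      * (\<integral>\<^sup>+x. ennpowr (SUP \<alpha>\<in>P_G \<delta> I Q apex x. ratio s \<omega> \<alpha>) q \<partial>m)"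
proof -
  let ?A = "sum_const s" and ?B = "2 * q * carleson_const s" and ?C = "sup_const s"
  let ?R = "\<integral>\<^sup>+x. ennpowr (SUP \<alpha>\<in>P_G \<delta> I Q apex x. ratio s \<omega> \<alpha>) q \<partial>m"
  define f where "f n x = ?A * (\<Sum>k\<le>n. level_fun k x)" for n x
  have f_nonneg: "0 \<le> f n x" for n x
    using sum_const_pos level_fun_nonneg by (simp add: f_def sum_nonneg less_imp_le)
  have pow_simple: "simple_function m (\<lambda>x. u x powr q)" if "simple_function m u"
    for u :: "'a \<Rightarrow> real"
    using simple_function_compose1[OF that, of "\<lambda>t. t powr q"] by simp
  have sum_simple: "simple_function m (\<lambda>x. \<Sum>k\<le>n. level_fun k x)" for n
    by (intro simple_function_sum simple_level_fun)
  have f_simple: "simple_function m (f n)" for n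
    unfolding f_def by (intro simple_function_mult sum_simple) simp
  have step: "(\<integral>\<^sup>+x. ennreal (f n x powr q) \<partial>m) \<le> ennreal ((?A * ?B * ?C) powr q) * ?R" for n
  proof -
    have "(\<integral>x. f n x powr q \<partial>m) = ?A powr q * (\<integral>x. (\<Sum>k\<le>n. level_fun k x) powr q \<partial>m)"
      by (simp add: f_def powr_mult)
    also have "\<dots> \<le> ?A powr q * (?B powr q * (\<integral>x. level_max n x powr q \<partial>m))"
      by (intro mult_left_mono sum_level_fun_powr_bound q) simp
    also have "\<dots> = (?A * ?B * ?C) powr q * (\<integral>x. (level_max n x / ?C) powr q \<partial>m)"
      using sup_const_pos[of s] by (simp add: powr_mult powr_divide)
    finally have le: "ennreal (\<integral>x. f n x powr q \<partial>m)
        \<le> ennreal ((?A * ?B * ?C) powr q) * ennreal (\<integral>x. (level_max n x / ?C) powr q \<partial>m)"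
      by (simp add: ennreal_mult'[symmetric] ennreal_leI)
    have "ennreal (\<integral>x. (level_max n x / ?C) powr q \<partial>m)
        = (\<integral>\<^sup>+x. ennreal ((level_max n x / ?C) powr q) \<partial>m)"
      by (intro nn_integral_eq_integral[symmetric] integrable_simple pow_simple
          simple_function_div simple_level_max) simp_all
    also have "\<dots> \<le> ?R"
      by (rule nn_integral_mono_AE, rule eventually_mono[OF AE_good], rule level_max_powr_le_SUP)
        (use q in auto)
    finally have max_le: "ennreal (\<integral>x. (level_max n x / ?C) powr q \<partial>m) \<le> ?R" .
    have "(\<integral>\<^sup>+x. ennreal (f n x powr q) \<partial>m) = ennreal (\<integral>x. f n x powr q \<partial>m)"
      by (intro nn_integral_eq_integral integrable_simple pow_simple f_simple) simp
    also note le
    also have "ennreal ((?A * ?B * ?C) powr q) * ennreal (\<integral>x. (level_max n x / ?C) powr q \<partial>m)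
        \<le> ennreal ((?A * ?B * ?C) powr q) * ?R"
      by (rule mult_left_mono[OF max_le]) simp
    finally show ?thesis .
  qed
  have "(\<integral>\<^sup>+x. ennpowr (\<Sum>\<^sub>\<infinity>\<alpha>\<in>P_G \<delta> I Q apex x. ratio s \<omega> \<alpha>) q \<partial>m)
      \<le> (\<integral>\<^sup>+x. (SUP n. ennreal (f n x powr q)) \<partial>m)"
  proof (rule nn_integral_mono_AE)
    show "AE x in m. ennpowr (\<Sum>\<^sub>\<infinity>\<alpha>\<in>P_G \<delta> I Q apex x. ratio s \<omega> \<alpha>) q
        \<le> (SUP n. ennreal (f n x powr q))"
      using AE_good
    proof eventually_elim
      case (elim x)
      have "ennpowr (\<Sum>\<^sub>\<infinity>\<alpha>\<in>P_G \<delta> I Q apex x. ratio s \<omega> \<alpha>) q \<le> ennpowr (SUP n. ennreal (f n x)) q"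
        unfolding f_def using q by (intro ennpowr_mono infsum_ratio_le elim) simp
      also have "\<dots> \<le> (SUP n. ennpowr (ennreal (f n x)) q)"
        using q by (intro ennpowr_SUP_le) simp
      finally show ?case by (simp add: ennpowr_ennreal f_nonneg)
    qed
  qed
  also have "\<dots> = (SUP n. \<integral>\<^sup>+x. ennreal (f n x powr q) \<partial>m)"
  proof (rule nn_integral_monotone_convergence_SUP)
    have "f n x \<le> f (Suc n) x" for n x
      using sum_const_pos level_fun_nonneg by (simp add: f_def mult_left_mono)
    then show "incseq (\<lambda>n x. ennreal (f n x powr q))"
      using q f_nonneg by (intro incseq_SucI le_funI ennreal_leI powr_mono2) auto
    show "(\<lambda>x. ennreal (f n x powr q)) \<in> borel_measurable m" for n
      using borel_measurable_simple_function[OF pow_simple[OF f_simple]] by measurable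
  qed
  also have "\<dots> \<le> ennreal ((?A * ?B * ?C) powr q) * ?R"
    by (intro SUP_least step)
  finally show ?thesis .
qed

end

end

theorem theorem20:
  fixes m :: "'a::complete_space measure"
    and c1 c2 D \<delta> a0 c4 s q :: real
    and I :: "nat \<Rightarrow> 'i set" and Q :: "nat \<Rightarrow> 'i \<Rightarrow> 'a set"
    and z :: "nat \<Rightarrow> 'i \<Rightarrow> 'a" and apex :: 'i
  assumes "ahlfors_regular m c1 c2 D"
    and "dyadic_system m \<delta> a0 c4 I Q z apex"
    and "0 < s" and "s < 1" and "1 \<le> q"
  shows "\<exists>c7>0. \<forall>\<omega> :: 'a measure. sets \<omega> = sets borel \<longrightarrow>
    (\<integral>\<^sup>+x. ennpowr (\<Sum>\<^sub>\<infinity>\<alpha>\<in>P_G \<delta> I Q apex x.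
        emeasure \<omega> (closure (cell Q \<alpha>)) / ennpowr (emeasure m (closure (cell Q \<alpha>))) s) q \<partial>m)
    \<le> ennreal c7 *
      (\<integral>\<^sup>+x. ennpowr (SUP \<alpha>\<in>P_G \<delta> I Q apex x.
        emeasure \<omega> (closure (cell Q \<alpha>)) / ennpowr (emeasure m (closure (cell Q \<alpha>))) s) q \<partial>m)"
proof -
  interpret dyadic_ahlfors m c1 c2 D \<delta> a0 c4 I Q z apex
    using assms(1,2) by (rule dyadic_ahlfors.intro)
  \<comment> \<open>The constant may depend on \<open>m\<close> but not on \<omega>, so the split on
    the measure of the space comes before its choice.\<close>
  show ?thesis
  proof (cases "emeasure m UNIV = top")
    case True
    then show ?thesis
      using infinite_measure_bound[of q _ s] assms(5)
      by (intro exI[of _ 1]) (simp add: ratio_def)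
  next
    case False
    then interpret finite_dyadic_ahlfors m c1 c2 D \<delta> a0 c4 I Q z apex
      by unfold_locales
    let ?c = "(sum_const s * (2 * q * carleson_const s) * sup_const s) powr q"
    have "0 < ?c"
      using sum_const_pos[of s] sup_const_pos[of s] carleson_const_pos[OF assms(4)] assms(5) by simp
    moreover have "(\<integral>\<^sup>+x. ennpowr (\<Sum>\<^sub>\<infinity>\<alpha>\<in>P_G \<delta> I Q apex x. ratio s \<omega> \<alpha>) q \<partial>m)
        \<le> ennreal ?c * (\<integral>\<^sup>+x. ennpowr (SUP \<alpha>\<in>P_G \<delta> I Q apex x. ratio s \<omega> \<alpha>) q \<partial>m)"
      if "sets \<omega> = sets borel" for \<omega>
    \<comment> \<open>For infinite \<omega> the right-hand integral is infinite; positivity of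
      \<open>?c\<close> matters since \<open>0 * top = 0\<close>.\<close>
    proof (cases "emeasure \<omega> UNIV = top")
      case True
      then show ?thesis
        using integral_SUP_top[OF True] assms(5) \<open>0 < ?c\<close> by (simp add: ennreal_mult_top)
    next
      case False
      then show ?thesis using that assms(3-5) by (intro finite_measure_bound)
    qed
    ultimately show ?thesis unfolding ratio_def by blast
  qed
qed

end
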